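(* Let $m,l,\delta\in\mathbb{N}$ and let $T$ be a tree with $T\in\mathcal{T}_{m,l+1}^{\delta}$. There exists $N\in\mathbb{N}$ such that for all $n>N$, every graph $G\in\mathrm{SPEX}(n,T)$ contains a copy of $K_{l,n-l}$.
   Context: Every tree $T$ has a unique bipartition $\{A,B\}$ with $|A|\le|B|$. $\mathcal{T}_{m,l+1}^{\delta}$ denotes the set of trees on $m$ vertices whose smaller partite set $A$ has exactly $l+1$ vertices and such that $\min\{d_T(v):v\in A\}=\delta$. For a graph $G$, $\lambda(G)$ is the largest eigenvalue of its adjacency matrix. $\mathrm{spex}(n,T)=\max\{\lambda(G): |V(G)|=n,\ G \text{ contains no subgraph isomorphic to } T\}$, and $\mathrm{SPEX}(n,T)$ is the set of $n$-vertex graphs containing no copy of $T$ with $\lambda(G)=\mathrm{spex}(n,T)$. *)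

theory Defs
  imports "Graph_Theory.Graph_Theory" "Jordan_Normal_Form.Char_Poly"
begin

text \<open>
  A finite simple graph is a \<^const>\<open>pair_graph\<close>: a finite symmetric loop-free digraph without
  parallel arcs, in which every edge is represented by its two orientations. The degree of a
  vertex is thus its \<^const>\<open>out_degree\<close>.
\<close>

text \<open>
  The library's \<^const>\<open>tree\<close> does not apply to symmetric digraphs, because there the two
  orientations of a single edge already form a \<^const>\<open>pre_digraph.cycle\<close>. The cycles of the
  undirected graph are those of length at least three. \<^const>\<open>connected\<close> excludes the null graph.
\<close>

definition is_tree :: "'a pair_pre_digraph \<Rightarrow> bool" where
  "is_tree T \<longleftrightarrow> pair_graph T \<and> connected (with_proj T) \<and>
     \<not> (\<exists>p. pre_digraph.cycle (with_proj T) p \<and> length p \<ge> 3)"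

definition bipartition :: "'a pair_pre_digraph \<Rightarrow> 'a set \<Rightarrow> 'a set \<Rightarrow> bool" where
  "bipartition G A B \<longleftrightarrow> A \<union> B = pverts G \<and> A \<inter> B = {} \<and> parcs G \<subseteq> A \<times> B \<union> B \<times> A"

text \<open>
  The set $\mathcal{T}_{m,k}^{\delta}$. If both partite sets have the same size, either of them may
  play the role of the smaller one.
\<close>

definition tree_class :: "nat \<Rightarrow> nat \<Rightarrow> nat \<Rightarrow> 'a pair_pre_digraph set" where
  "tree_class m k \<delta> = {T. is_tree T \<and> card (pverts T) = m \<and>
     (\<exists>A B. bipartition T A B \<and> card A \<le> card B \<and> card A = k \<and>
       Min (out_degree (with_proj T) ` A) = \<delta>)}"

definition contains_copy :: "'b pair_pre_digraph \<Rightarrow> 'a pair_pre_digraph \<Rightarrow> bool" where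
  "contains_copy G F \<longleftrightarrow>
     (\<exists>H. subgraph (with_proj H) (with_proj G) \<and> digraph_iso (with_proj F) (with_proj H))"

text \<open>
  Graphs on $n$ vertices are taken on the vertex set $\{0,\dots,n-1\}$, which also indexes the rows
  and columns of the adjacency matrix.
\<close>

definition graphs_on :: "nat \<Rightarrow> nat pair_pre_digraph set" where
  "graphs_on n = {G. pair_graph G \<and> pverts G = {..<n}}"

definition adj_matrix :: "nat pair_pre_digraph \<Rightarrow> real mat" where
  "adj_matrix G = mat (card (pverts G)) (card (pverts G))
     (\<lambda>(i, j). if (i, j) \<in> parcs G then 1 else 0)"

definition largest_eigenvalue :: "nat pair_pre_digraph \<Rightarrow> real" where
  "largest_eigenvalue G = Max {x. eigenvalue (adj_matrix G) x}"

definition spex :: "nat \<Rightarrow> 'a pair_pre_digraph \<Rightarrow> real" where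
  "spex n T = Max {largest_eigenvalue G | G. G \<in> graphs_on n \<and> \<not> contains_copy G T}"

definition SPEX :: "nat \<Rightarrow> 'a pair_pre_digraph \<Rightarrow> nat pair_pre_digraph set" where
  "SPEX n T = {G \<in> graphs_on n. \<not> contains_copy G T \<and> largest_eigenvalue G = spex n T}"

definition contains_complete_bipartite :: "nat pair_pre_digraph \<Rightarrow> nat \<Rightarrow> nat \<Rightarrow> bool" where
  "contains_complete_bipartite G a b \<longleftrightarrow>
     (\<exists>H :: nat pair_pre_digraph.
        subgraph (with_proj H) (with_proj G) \<and> K\<^bsub>a,b\<^esub> (with_proj H))"

end

theory Submission
  imports Defs "HOL-Analysis.Function_Topology"
begin

text \<open>
  Let $x$ be a nonnegative eigenvector for $\lambda = \lambda(G)$ with maximal entry $1$, where $G$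
  is extremal; comparing with $K_{l,n-l}$ gives $\lambda^2 \ge l(n-l)$. Greedy embedding of $T$
  shows that a $T$-free graph is sparse, and that between disjoint sets $P$, $Q$ it has at most
  $m|P| + l|Q|$ edges. Hence only $O(\sqrt n)$ vertices have an entry at least $\epsilon$, all but
  $O(\sqrt n)$ of the vertices have at most $l$ neighbours among those, and counting walks of
  length two yields $\lambda^2 x_v \le l\,d(v) + o(n)$. For a vertex with $x_v = 1$ this is tight up
  to $o(n)$, which forces $l$ vertices with entries close to $1$. Each of them is joined to almost
  all vertices, so they have a large common neighbourhood $R$, and a further vertex with entry
  bounded away from $0$ would create a $K_{l+1,m}$, which contains $T$. Let $M$ be this set of $l$
  vertices. If some vertices lie outside $M \cup R$, replace all edges at them by edges to all of
  $M$. The result is still $T$-free, since these vertices can be exchanged for unused vertices of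
  $R$, but it has a larger $\lambda$.
\<close>

section \<open>Copies of trees\<close>

text \<open>Bare vertex sets and relations keep the combinatorics free of digraph records. The image
  need not be induced: the host may have further edges among the image vertices.\<close>

definition embeds :: "'a set \<Rightarrow> 'a rel \<Rightarrow> 'b set \<Rightarrow> 'b rel \<Rightarrow> bool" where
  "embeds W F V E \<longleftrightarrow> (\<exists>f. inj_on f W \<and> f ` W \<subseteq> V \<and> (\<forall>u v. (u, v) \<in> F \<longrightarrow> (f u, f v) \<in> E))"

text \<open>Trees in the form that a greedy embedding consumes: a new vertex has exactly one
  neighbour among the earlier ones, so only one edge has to be respected when it is placed.\<close>

inductive tree_growth :: "'a rel \<Rightarrow> 'a set \<Rightarrow> bool" for F where
  single: "tree_growth F {v}"
| leaf: "\<lbrakk>tree_growth F W; v \<notin> W; u \<in> W; {w \<in> W. (v, w) \<in> F} = {u}\<rbrakk> \<Longrightarrow> tree_growth F (insert v W)"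

lemma tree_growth_finite: "tree_growth F W \<Longrightarrow> finite W"
  by (induction rule: tree_growth.induct) auto

text \<open>The vertex part of an isomorphism onto a subgraph is an embedding; conversely the image
  of \<open>F\<close> under \<open>f\<close> is the required subgraph.\<close>

lemma contains_copy_iff_embeds:
  assumes "pair_wf_digraph F" "pair_wf_digraph G"
  shows "contains_copy G F \<longleftrightarrow> embeds (pverts F) (parcs F) (pverts G) (parcs G)"
proof
  interpret F: pair_wf_digraph F by fact
  assume "contains_copy G F"
  then obtain H h where H: "subgraph (with_proj H) (with_proj G)"
    and h: "pre_digraph.digraph_isomorphism (with_proj F) h" "with_proj H = app_iso h (with_proj F)"
    unfolding contains_copy_def digraph_iso_def by blast
  \<comment> \<open>Comparing the two records forces tails and heads to be the projections, so the
    arc map is determined by the vertex map.\<close>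
  have tl: "iso_tail h = fst" "iso_head h = snd"
    using h(2) by (simp_all add: with_proj_def app_iso_def)
  have vs: "pverts H = iso_verts h ` pverts F" "parcs H = iso_arcs h ` parcs F"
    using h(2) by (simp_all add: with_proj_def app_iso_def)
  have "inj_on (iso_verts h) (pverts F)"
    using h(1) by (simp add: pre_digraph.digraph_isomorphism_def)
  moreover have "iso_verts h ` pverts F \<subseteq> pverts G"
    using H vs by (simp add: subgraph_def)
  moreover have "(iso_verts h u, iso_verts h v) \<in> parcs G" if "(u, v) \<in> parcs F" for u v
  proof -
    have "iso_arcs h (u, v) = (iso_verts h u, iso_verts h v)"
      using h(1) that tl by (auto simp: pre_digraph.digraph_isomorphism_def intro: prod_eqI)
    then show ?thesis using H vs that by (force simp: subgraph_def)
  qed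
  ultimately show "embeds (pverts F) (parcs F) (pverts G) (parcs G)"
    unfolding embeds_def by blast
next
  interpret F: pair_wf_digraph F by fact
  interpret G: pair_wf_digraph G by fact
  assume "embeds (pverts F) (parcs F) (pverts G) (parcs G)"
  then obtain f where f: "inj_on f (pverts F)" "f ` pverts F \<subseteq> pverts G"
    "\<And>u v. (u, v) \<in> parcs F \<Longrightarrow> (f u, f v) \<in> parcs G"
    unfolding embeds_def by blast
  define H where "H = \<lparr>pverts = f ` pverts F, parcs = map_prod f f ` parcs F\<rparr>"
  define h where "h = \<lparr>iso_verts = f, iso_arcs = map_prod f f, iso_head = snd, iso_tail = fst\<rparr>"
  have "inj_on (map_prod f f) (parcs F)"
    by (rule inj_on_subset[of _ "pverts F \<times> pverts F"])
      (use f(1) in \<open>auto simp: inj_on_def dest: F.in_arcsD1 F.in_arcsD2\<close>)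
  then have "pre_digraph.digraph_isomorphism (with_proj F) h"
    using f(1) F.wf_digraph_axioms by (auto simp: pre_digraph.digraph_isomorphism_def h_def)
  moreover have "with_proj H = app_iso h (with_proj F)"
    by (simp add: H_def h_def with_proj_def app_iso_def)
  moreover have "pair_wf_digraph H"
    by unfold_locales (auto simp: H_def dest: F.in_arcsD1 F.in_arcsD2)
  then have "subgraph (with_proj H) (with_proj G)"
    using f G.wf_digraph_axioms by (auto simp: subgraph_def H_def wf_digraph_wp_iff)
  ultimately show "contains_copy G F"
    unfolding contains_copy_def digraph_iso_def by blast
qed

section \<open>Building a tree leaf by leaf\<close>

lemma set_rev_path: "set (rev_path p) = prod.swap ` set p"
  by (induction p) auto

text \<open>The walk has to stay inside \<open>W\<close>, because \<open>is_tree_tree_growth\<close>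
  closes it to a cycle through a vertex outside \<open>W\<close>. A new leaf is reached through its
  neighbour \<open>u\<close>, and the way back is the reversed walk.\<close>

lemma (in pair_graph) tree_growth_connected:
  assumes "tree_growth (parcs G) W" "W \<subseteq> pverts G" "a \<in> W" "b \<in> W"
  shows "\<exists>p. awalk a p b \<and> set p \<subseteq> W \<times> W"
  using assms
proof (induction arbitrary: a b rule: tree_growth.induct)
  case (single v)
  then show ?case by (intro exI[of _ "[]"]) (auto simp: awalk_Nil_iff)
next
  case (leaf W v u)
  have vu: "(v, u) \<in> parcs G" "(u, v) \<in> parcs G"
    using leaf.hyps arcs_symmetric by auto
  have av: "\<exists>p. awalk x p v \<and> set p \<subseteq> insert v W \<times> insert v W" if x: "x \<in> W" for x
  proof -
    obtain p where p: "awalk x p u" "set p \<subseteq> W \<times> W"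
      using leaf.IH[OF _ x \<open>u \<in> W\<close>] leaf.prems(1) by auto
    have q: "awalk u [(u, v)] v" using vu by (auto simp: awalk_simps dest: in_arcsD1 in_arcsD2)
    show ?thesis using awalk_appendI[OF p(1) q] p(2) leaf.hyps(3)
      by (intro exI[of _ "p @ [(u, v)]"]) auto
  qed
  have va: "\<exists>p. awalk v p x \<and> set p \<subseteq> insert v W \<times> insert v W" if x: "x \<in> W" for x
  proof -
    obtain p where p: "awalk x p v" "set p \<subseteq> insert v W \<times> insert v W" using av[OF x] by blast
    then show ?thesis
      by (intro exI[of _ "rev_path p"]) (auto simp: set_rev_path)
  qed
  have vv: "\<exists>p. awalk v p v \<and> set p \<subseteq> insert v W \<times> insert v W"
    using leaf.prems(1) by (intro exI[of _ "[]"]) (auto simp: awalk_Nil_iff)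
  have ww: "\<exists>p. awalk x p y \<and> set p \<subseteq> insert v W \<times> insert v W" if "x \<in> W" "y \<in> W" for x y
    using leaf.IH[of x y] that leaf.prems(1) by blast
  show ?case using leaf.prems av va vv ww by blast
qed

text \<open>Connectedness refers to the symmetric closure, so for symmetric digraphs it becomes
  strong connectivity.\<close>

lemma (in pair_sym_digraph) mk_symmetric_self: "mk_symmetric (with_proj G) = G"
proof -
  have "(\<Union>e\<in>parcs G. {(fst e, snd e), (snd e, fst e)}) = parcs G"
    using arcs_symmetric by auto
  then show ?thesis by (simp add: mk_symmetric_def)
qed

text \<open>Take a maximal grown set \<open>W\<close>. If it is not everything, connectedness yields
  an edge from some \<open>u\<close> in \<open>W\<close> to some \<open>v\<close> outside. A second
  neighbour of \<open>v\<close> in \<open>W\<close> would close a cycle, so \<open>v\<close> can be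
  added as a leaf, against maximality.\<close>

lemma is_tree_tree_growth:
  assumes "is_tree T"
  shows "tree_growth (parcs T) (pverts T)"
proof -
  interpret pair_graph T using assms by (simp add: is_tree_def)
  have conn: "strongly_connected (with_proj T)"
    using assms by (simp add: is_tree_def Digraph_Component.connected_def mk_symmetric_self)
  have acyc: "\<not> (cycle p \<and> length p \<ge> 3)" for p
    using assms by (simp add: is_tree_def)
  obtain r where r: "r \<in> pverts T"
    using conn by (auto simp: strongly_connected_def)
  define \<W> where "\<W> = {W. W \<subseteq> pverts T \<and> tree_growth (parcs T) W}"
  have "finite \<W>" unfolding \<W>_def using pair_finite_verts by simp
  moreover have "{r} \<in> \<W>" using r by (auto simp: \<W>_def intro: tree_growth.single)
  ultimately obtain W where W: "W \<in> \<W>" and mx: "\<And>W'. W' \<in> \<W> \<Longrightarrow> W \<subseteq> W' \<Longrightarrow> W' = W"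
    by (metis finite_has_maximal2)
  have WT: "W \<subseteq> pverts T" "tree_growth (parcs T) W" using W by (auto simp: \<W>_def)
  have "W \<noteq> {}" using WT(2) by (cases rule: tree_growth.cases) auto
  have "pverts T \<subseteq> W"
  proof (rule ccontr)
    assume "\<not> pverts T \<subseteq> W"
    then obtain b where b: "b \<in> pverts T" "b \<notin> W" by auto
    obtain a where a: "a \<in> W" using \<open>W \<noteq> {}\<close> by auto
    have "a \<rightarrow>\<^sup>*\<^bsub>with_proj T\<^esub> b" using conn a b WT(1) by (auto simp: strongly_connected_def)
    then have "(a, b) \<in> rtrancl_on (pverts T) (parcs T)" by (simp add: reachable_def)
    then have "\<exists>u v. u \<in> W \<and> v \<in> pverts T - W \<and> (u, v) \<in> parcs T"
      using a b by (induction rule: rtrancl_on_induct) auto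
    then obtain u v where uv: "u \<in> W" "v \<in> pverts T" "v \<notin> W" "(u, v) \<in> parcs T" by auto
    have "w = u" if w: "w \<in> W" "(v, w) \<in> parcs T" for w
    proof (rule ccontr)
      assume "w \<noteq> u"
      obtain p where p: "awalk w p u" "set p \<subseteq> W \<times> W"
        using tree_growth_connected[OF WT(2,1) w(1) uv(1)] by auto
      define q where "q = awalk_to_apath p"
      have q: "apath w q u" "set q \<subseteq> W \<times> W"
        using apath_awalk_to_apath[OF p(1)] awalk_to_apath_subset[OF p(1)] p(2) by (auto simp: q_def)
      then have qW: "set (pawalk_verts w q) \<subseteq> W"
        using set_awalk_verts[of w q u] w(1) by (auto simp: apath_def)
      have qw: "awalk w q u" "distinct (pawalk_verts w q)" using q by (auto simp: apath_def)
      have "q \<noteq> []" using qw(1) \<open>w \<noteq> u\<close> by (auto simp: awalk_Nil_iff)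
      have e: "awalk u [(u, v)] v" using uv by (auto simp: awalk_simps dest: in_arcsD1)
      have wv: "awalk w (q @ [(u, v)]) v" by (rule awalk_appendI[OF qw(1) e])
      have vv: "awalk v ((v, w) # q @ [(u, v)]) v"
        unfolding awalk_Cons_iff fst_conv snd_conv by (intro conjI w(2) wv refl)
      have "pawalk_verts w (q @ [(u, v)]) = pawalk_verts w q @ [v]"
        using awalk_verts_append[OF wv] awlast_if_cas qw(1) by (auto simp: awalk_def)
      then have "distinct (tl (pawalk_verts v ((v, w) # q @ [(u, v)])))"
        using qw(2) qW uv(3) by auto
      then have "cycle ((v, w) # q @ [(u, v)])"
        using vv unfolding cycle_def by blast
      \<comment> \<open>A nonempty \<open>q\<close> separates this closed walk from the two-arc
        cycles formed by the orientations of a single edge.\<close>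
      moreover have "length ((v, w) # q @ [(u, v)]) \<ge> 3" using \<open>q \<noteq> []\<close> by (cases q) auto
      ultimately show False using acyc by blast
    qed
    then have "{w \<in> W. (v, w) \<in> parcs T} = {u}" using uv arcs_symmetric by blast
    then have "tree_growth (parcs T) (insert v W)"
      using uv WT(2) by (blast intro: tree_growth.leaf)
    then have "insert v W \<in> \<W>" using uv WT(1) by (auto simp: \<W>_def)
    then show False using mx[of "insert v W"] uv(3) by blast
  qed
  then show ?thesis using WT by (simp add: subset_antisym)
qed

text \<open>Greedy embedding in which \<open>H v\<close> lists the images allowed for
  \<open>v\<close>. Only vertices whose lists meet \<open>H v\<close> compete for places in it, so
  the degree condition leaves a free neighbour of the image of \<open>u\<close>. Counting
  competitors instead of all vertices is what later gives different thresholds on the two sides of a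
  bipartite host.\<close>

lemma tree_growth_embedding:
  assumes "tree_growth F W" "finite U" "W \<subseteq> U" "sym F" "irrefl F" "sym E"
    and ne: "\<And>v. v \<in> U \<Longrightarrow> H v \<noteq> {}"
    and deg: "\<And>u v x. \<lbrakk>u \<in> U; v \<in> U; (u, v) \<in> F; x \<in> H u\<rbrakk> \<Longrightarrow>
      card {w \<in> U. H w \<inter> H v \<noteq> {}} \<le> card {y \<in> H v. (x, y) \<in> E}"
  shows "\<exists>f. inj_on f W \<and> (\<forall>v\<in>W. f v \<in> H v) \<and>
    (\<forall>u\<in>W. \<forall>v\<in>W. (u, v) \<in> F \<longrightarrow> (f u, f v) \<in> E)"
  using assms(1,3)
proof (induction rule: tree_growth.induct)
  case (single v)
  obtain x where "x \<in> H v" using ne single by fastforce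
  then show ?case using \<open>irrefl F\<close> by (intro exI[of _ "\<lambda>_. x"]) (auto simp: irrefl_def)
next
  case (leaf W v u)
  obtain f where f: "inj_on f W" "\<And>w. w \<in> W \<Longrightarrow> f w \<in> H w"
    "\<And>w w'. w \<in> W \<Longrightarrow> w' \<in> W \<Longrightarrow> (w, w') \<in> F \<Longrightarrow> (f w, f w') \<in> E"
    using leaf.IH leaf.prems by blast
  have vu: "(v, u) \<in> F" "(u, v) \<in> F" using leaf.hyps(4) \<open>sym F\<close> by (auto dest: symD)
  let ?N = "{y \<in> H v. (f u, y) \<in> E}" and ?C = "{w \<in> U. H w \<inter> H v \<noteq> {}}"
  have vC: "v \<in> ?C" using ne leaf.prems by auto
  have fin: "finite ?C" using \<open>finite U\<close> by simp
  have "f ` W \<inter> H v \<subseteq> f ` (?C - {v})"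
    using f(2) leaf.prems leaf.hyps(2) by auto
  then have "card (f ` W \<inter> H v) \<le> card (?C - {v})"
    using fin by (meson card_image_le card_mono finite_Diff finite_imageI le_trans)
  \<comment> \<open>\<open>v\<close> is counted in \<open>?C\<close> but has no image yet; this
    makes the inequality strict.\<close>
  also have "\<dots> < card ?C" using fin vC by (meson card_Diff1_less)
  also have "\<dots> \<le> card ?N"
    using deg[of u v "f u"] leaf.prems leaf.hyps(3) vu f(2) by auto
  finally have "\<not> ?N \<subseteq> f ` W \<inter> H v"
    using \<open>finite U\<close> leaf.prems by (meson card_mono finite_Int finite_imageI finite_subset insert_subset not_le)
  then obtain y where y: "y \<in> H v" "(f u, y) \<in> E" "y \<notin> f ` W" by auto
  let ?f = "f(v := y)"
  have "inj_on ?f (insert v W)"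
    using f(1) y(3) leaf.hyps(2) by (auto simp: inj_on_def)
  moreover have "\<forall>w\<in>insert v W. ?f w \<in> H w" using f(2) y(1) by auto
  moreover have "(?f a, ?f b) \<in> E" if ab: "a \<in> insert v W" "b \<in> insert v W" "(a, b) \<in> F" for a b
  proof -
    have "(a, b) = (v, u) \<or> (a, b) = (u, v) \<or> a \<noteq> v \<and> b \<noteq> v"
      using ab leaf.hyps(4) \<open>sym F\<close> \<open>irrefl F\<close> by (auto simp: irrefl_def dest: symD)
    then show ?thesis
      using ab f(3) y(2) leaf.hyps(2,3) \<open>sym E\<close> by (auto dest: symD)
  qed
  ultimately show ?case by blast
qed

text \<open>Remove vertices one by one, each with at most \<open>c v\<close> neighbours in what is
  left, and charge an edge to the endpoint removed first, at a cost of at most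
  \<open>\<eta> * x v\<close>. Both orientations are summed, hence the factor 2. The bound
  \<open>c\<close> depends on the vertex because the bipartite application has different bounds on
  its two sides.\<close>

lemma peeling_sum_le:
  fixes c :: "'a \<Rightarrow> nat" and x :: "'a \<Rightarrow> real"
  assumes "finite S" "sym E" and x: "\<And>v. v \<in> S \<Longrightarrow> 0 \<le> x v" "\<And>v. v \<in> S \<Longrightarrow> x v \<le> \<eta>"
    and peel: "\<And>S'. S' \<subseteq> S \<Longrightarrow> S' \<noteq> {} \<Longrightarrow> \<exists>v\<in>S'. card {w \<in> S'. (v, w) \<in> E} \<le> c v"
  shows "(\<Sum>v\<in>S. \<Sum>w\<in>{w \<in> S. (v, w) \<in> E}. x v * x w) \<le> 2 * \<eta> * (\<Sum>v\<in>S. c v * x v)"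
  using assms(1,3-)
proof (induction S rule: finite_remove_induct)
  case empty
  then show ?case by simp
next
  case (remove S)
  obtain v where v: "v \<in> S" "card {w \<in> S. (v, w) \<in> E} \<le> c v"
    using remove.prems(3)[of S] remove.hyps(2) by auto
  define S' where "S' = S - {v}"
  have S: "S = insert v S'" "v \<notin> S'" "finite S'" using v remove.hyps by (auto simp: S'_def)
  have \<eta>: "0 \<le> \<eta>" using remove.prems(1,2)[OF v(1)] by linarith
  have IH: "(\<Sum>a\<in>S'. \<Sum>w\<in>{w \<in> S'. (a, w) \<in> E}. x a * x w) \<le> 2 * \<eta> * (\<Sum>v\<in>S'. c v * x v)"
    unfolding S'_def
  proof (rule remove.IH[OF v(1)])
    show "0 \<le> x u" if "u \<in> S - {v}" for u using that remove.prems(1) by auto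
    show "x u \<le> \<eta>" if "u \<in> S - {v}" for u using that remove.prems(2) by auto
    show "\<exists>v\<in>S'. card {w \<in> S'. (v, w) \<in> E} \<le> c v" if "S' \<subseteq> S - {v}" "S' \<noteq> {}" for S'
      using that remove.prems(3)[of S'] by blast
  qed
  define d where "d a = (if (a, v) \<in> E then x a * x v else 0)" for a
  have dv: "(\<Sum>w\<in>{w \<in> S. (v, w) \<in> E}. x v * x w) = (\<Sum>w\<in>S. d w)"
    unfolding d_def sum.inter_filter[OF remove.hyps(1), symmetric]
    by (rule sum.cong) (use \<open>sym E\<close> in \<open>auto dest: symD simp: mult.commute\<close>)
  have da: "(\<Sum>w\<in>{w \<in> S. (a, w) \<in> E}. x a * x w) = (\<Sum>w\<in>{w \<in> S'. (a, w) \<in> E}. x a * x w) + d a"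
    if "a \<in> S'" for a
  proof (cases "(a, v) \<in> E")
    case True
    then have "{w \<in> S. (a, w) \<in> E} = insert v {w \<in> S'. (a, w) \<in> E}" using S by auto
    then show ?thesis using True S by (simp add: d_def)
  next
    case False
    then have "{w \<in> S. (a, w) \<in> E} = {w \<in> S'. (a, w) \<in> E}" using S by auto
    then show ?thesis using False by (simp add: d_def)
  qed
  have d0: "0 \<le> d a" if "a \<in> S" for a using that remove.prems(1) v(1) by (simp add: d_def)
  have "(\<Sum>a\<in>S. \<Sum>w\<in>{w \<in> S. (a, w) \<in> E}. x a * x w) =
      (\<Sum>w\<in>S. d w) + (\<Sum>a\<in>S'. (\<Sum>w\<in>{w \<in> S'. (a, w) \<in> E}. x a * x w) + d a)"
    using S dv da by (simp add: sum.insert)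
  also have "\<dots> \<le> 2 * (\<Sum>w\<in>S. d w) + 2 * \<eta> * (\<Sum>v\<in>S'. c v * x v)"
  proof -
    \<comment> \<open>The row and the column of \<open>v\<close> contribute equally, except that a
      loop at \<open>v\<close> would occur only in the row.\<close>
    have "(\<Sum>a\<in>S'. d a) \<le> (\<Sum>a\<in>S. d a)"
      using d0 remove.hyps(1) by (intro sum_mono2) (auto simp: S'_def)
    then show ?thesis using IH by (simp add: sum.distrib)
  qed
  also have "(\<Sum>w\<in>S. d w) \<le> \<eta> * (c v * x v)"
  proof -
    have "(\<Sum>w\<in>S. d w) \<le> (\<Sum>w\<in>{w \<in> S. (v, w) \<in> E}. x v * \<eta>)"
      unfolding dv[symmetric] by (intro sum_mono mult_left_mono) (use remove.prems(1,2) v(1) in auto)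
    also have "\<dots> = card {w \<in> S. (v, w) \<in> E} * (x v * \<eta>)" by simp
    also have "\<dots> \<le> c v * (x v * \<eta>)"
      using v \<eta> remove.prems(1) by (intro mult_right_mono) auto
    finally show ?thesis by (simp add: mult_ac)
  qed
  finally show ?case using S by (simp add: algebra_simps)
qed

section \<open>Sparsity of graphs without a given tree\<close>

lemma sum_card_swap:
  assumes "finite P" "finite Q" "sym E"
  shows "(\<Sum>p\<in>P. card {q \<in> Q. (p, q) \<in> E}) = (\<Sum>q\<in>Q. card {p \<in> P. (q, p) \<in> E})"
proof -
  have "(\<Sum>p\<in>P. card {q \<in> Q. (p, q) \<in> E}) = (\<Sum>p\<in>P. \<Sum>q\<in>Q. if (p, q) \<in> E then 1 else 0)"
    using assms by (simp add: sum.inter_filter[symmetric])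
  also have "\<dots> = (\<Sum>q\<in>Q. \<Sum>p\<in>P. if (q, p) \<in> E then 1 else 0)"
    by (subst sum.swap) (intro sum.cong refl, use \<open>sym E\<close> in \<open>auto dest: symD\<close>)
  also have "\<dots> = (\<Sum>q\<in>Q. card {p \<in> P. (q, p) \<in> E})"
    using assms by (simp add: sum.inter_filter[symmetric])
  finally show ?thesis .
qed

section \<open>Embedding a tree with given partite sets\<close>

locale bipartite_tree =
  fixes W A B :: "'a set" and F :: "'a rel" and l :: nat
  assumes growth: "tree_growth F W" and sym_F: "sym F"
    and W_eq: "W = A \<union> B" and A_B: "A \<inter> B = {}" and F_sub: "F \<subseteq> A \<times> B \<union> B \<times> A"
    and card_A: "card A = l + 1"
begin

abbreviation m :: nat where "m \<equiv> card W"

lemma finite_W: "finite W" by (rule tree_growth_finite[OF growth])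

lemma irrefl_F: "irrefl F" using F_sub A_B by (auto simp: irrefl_def)

lemma l_less_m: "l < m"
  using card_mono[OF finite_W, of A] card_A W_eq by auto

lemma embedsI:
  assumes "sym E" "\<And>v. v \<in> W \<Longrightarrow> H v \<noteq> {}" "\<And>v. v \<in> W \<Longrightarrow> H v \<subseteq> V"
    and "\<And>u v x. \<lbrakk>u \<in> W; v \<in> W; (u, v) \<in> F; x \<in> H u\<rbrakk> \<Longrightarrow>
      card {w \<in> W. H w \<inter> H v \<noteq> {}} \<le> card {y \<in> H v. (x, y) \<in> E}"
  shows "embeds W F V E"
proof -
  obtain f where f: "inj_on f W" "\<forall>v\<in>W. f v \<in> H v" "\<forall>u\<in>W. \<forall>v\<in>W. (u, v) \<in> F \<longrightarrow> (f u, f v) \<in> E"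
    using tree_growth_embedding[OF growth finite_W subset_refl sym_F irrefl_F assms(1), of H] assms(2,4)
    by blast
  have "u \<in> W \<and> v \<in> W" if "(u, v) \<in> F" for u v using that F_sub W_eq by auto
  then show ?thesis unfolding embeds_def using f assms(3) by blast
qed

lemma embeds_large_degrees:
  assumes "sym E" "S \<subseteq> V" "S \<noteq> {}" "\<And>v. v \<in> S \<Longrightarrow> m \<le> card {w \<in> S. (v, w) \<in> E}"
  shows "embeds W F V E"
  by (rule embedsI[of E "\<lambda>_. S"]) (use assms in auto)

text \<open>Map \<open>A\<close> into \<open>P\<close> and \<open>B\<close> into \<open>Q\<close>.
  Since \<open>P\<close> and \<open>Q\<close> are disjoint, only the \<open>l + 1\<close> vertices
  of \<open>A\<close> compete for places in \<open>P\<close>, so degree \<open>l + 1\<close> towards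
  \<open>P\<close> suffices. This asymmetry is the source of the coefficient \<open>l\<close> in
  \<open>bipartite_edges_le\<close>.\<close>

lemma embeds_bipartite:
  assumes "sym E" "P \<subseteq> V" "Q \<subseteq> V" "P \<inter> Q = {}" "P \<union> Q \<noteq> {}"
    and P: "\<And>p. p \<in> P \<Longrightarrow> m \<le> card {q \<in> Q. (p, q) \<in> E}"
    and Q: "\<And>q. q \<in> Q \<Longrightarrow> l + 1 \<le> card {p \<in> P. (q, p) \<in> E}"
  shows "embeds W F V E"
proof (rule embedsI[of E "\<lambda>v. if v \<in> A then P else Q"])
  have "Q \<noteq> {}" if "p \<in> P" for p using P[OF that] l_less_m by auto
  moreover have "P \<noteq> {}" if "q \<in> Q" for q using Q[OF that] by auto
  ultimately have ne: "P \<noteq> {}" "Q \<noteq> {}" using assms(5) by blast+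
  show "(if v \<in> A then P else Q) \<noteq> {}" for v using ne by simp
  show "(if v \<in> A then P else Q) \<subseteq> V" for v using assms by simp
  fix u v x
  assume *: "u \<in> W" "v \<in> W" "(u, v) \<in> F" "x \<in> (if u \<in> A then P else Q)"
  let ?C = "{w \<in> W. (if w \<in> A then P else Q) \<inter> (if v \<in> A then P else Q) \<noteq> {}}"
  have "card ?C \<le> m" using finite_W by (intro card_mono) auto
  moreover have "?C = A" if "v \<in> A" using that assms(4) ne W_eq by auto
  moreover have "v \<in> A \<longleftrightarrow> u \<notin> A" using * F_sub A_B by auto
  ultimately show "card ?C \<le> card {y \<in> if v \<in> A then P else Q. (x, y) \<in> E}"
    using P[of x] Q[of x] * card_A by (cases "v \<in> A") (auto split: if_splits)
qed (fact assms)

text \<open>A tree has only one 2-colouring up to swapping the colours, so an embedding puts all of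
  \<open>A\<close> or all of \<open>B\<close> into \<open>P\<close>, and both are too large for
  that.\<close>

lemma not_embeds_bipartite:
  assumes "E \<subseteq> P \<times> Q \<union> Q \<times> P" "P \<inter> Q = {}" "finite P" "card P \<le> l" "card A \<le> card B" "V \<subseteq> P \<union> Q"
  shows "\<not> embeds W F V E"
proof
  assume "embeds W F V E"
  then obtain f where f: "inj_on f W" "f ` W \<subseteq> V" "\<And>u v. (u, v) \<in> F \<Longrightarrow> (f u, f v) \<in> E"
    unfolding embeds_def by blast
  \<comment> \<open>Uniqueness of the colouring along the growth of the tree: the edge to the new
    leaf switches sides both in the tree and in the host.\<close>
  have "W' \<subseteq> W \<Longrightarrow> {v \<in> W'. f v \<in> P} = A \<inter> W' \<or> {v \<in> W'. f v \<in> P} = B \<inter> W'"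
    if "tree_growth F W'" for W'
    using that
  proof (induction rule: tree_growth.induct)
    case (single v)
    then show ?case using W_eq A_B by auto
  next
    case (leaf W' v u)
    have vu: "(v, u) \<in> F" using leaf.hyps by auto
    have 1: "f v \<in> P \<longleftrightarrow> f u \<notin> P" using f(3)[OF vu] assms(1,2) by auto
    have 2: "v \<in> A \<longleftrightarrow> u \<in> B" "v \<in> B \<longleftrightarrow> u \<in> A" "u \<in> A \<longleftrightarrow> u \<notin> B" using vu F_sub A_B by auto
    from leaf consider "{v \<in> W'. f v \<in> P} = A \<inter> W'" | "{v \<in> W'. f v \<in> P} = B \<inter> W'" by auto
    then show ?case
    proof cases
      case 1
      then have "f u \<in> P \<longleftrightarrow> u \<in> A" using leaf.hyps(3) by auto
      then have "f v \<in> P \<longleftrightarrow> v \<in> A" using \<open>f v \<in> P \<longleftrightarrow> _\<close> 2 by auto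
      then have "{v' \<in> insert v W'. f v' \<in> P} = A \<inter> insert v W'" using 1 by auto
      then show ?thesis by blast
    next
      case 2
      then have "f u \<in> P \<longleftrightarrow> u \<in> B" using leaf.hyps(3) by auto
      then have "f v \<in> P \<longleftrightarrow> v \<in> B" using \<open>f v \<in> P \<longleftrightarrow> _\<close> \<open>v \<in> B \<longleftrightarrow> _\<close> \<open>u \<in> A \<longleftrightarrow> _\<close> by auto
      then have "{v' \<in> insert v W'. f v' \<in> P} = B \<inter> insert v W'" using 2 by auto
      then show ?thesis by blast
    qed
  qed
  from this[OF growth] have "{v \<in> W. f v \<in> P} = A \<or> {v \<in> W. f v \<in> P} = B" using W_eq by auto
  then have "card {v \<in> W. f v \<in> P} \<ge> l + 1" using card_A assms(5) by auto
  moreover have "card {v \<in> W. f v \<in> P} \<le> card P"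
    by (rule card_inj_on_le[of f]) (use f(1) assms(3) in \<open>auto simp: inj_on_def\<close>)
  ultimately show False using assms(4) by simp
qed

end

section \<open>Edge counts in a graph without the tree\<close>

locale tree_free = bipartite_tree W A B F l
  for W A B :: "'a set" and F l +
  fixes V :: "'b set" and E :: "'b rel"
  assumes finite_V: "finite V" and sym_E: "sym E" and irrefl_E: "irrefl E" and E_sub: "E \<subseteq> V \<times> V"
    and tree_free: "\<not> embeds W F V E"
begin

definition N :: "'b \<Rightarrow> 'b set" where "N v = {w \<in> V. (v, w) \<in> E}"

lemma finite_N [simp]: "finite (N v)" by (simp add: N_def finite_V)

lemma N_sub: "N v \<subseteq> V" by (auto simp: N_def)

lemma N_Int: "S \<subseteq> V \<Longrightarrow> N v \<inter> S = {w \<in> S. (v, w) \<in> E}" by (auto simp: N_def)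

lemma finite_sub: "S \<subseteq> V \<Longrightarrow> finite S" using finite_V finite_subset by blast

text \<open>A graph without the tree is m-degenerate; otherwise greedy embedding succeeds inside
  \<open>S\<close>.\<close>

lemma peel:
  assumes "S \<subseteq> V" "S \<noteq> {}"
  shows "\<exists>v\<in>S. card {w \<in> S. (v, w) \<in> E} \<le> m"
  using embeds_large_degrees[OF sym_E assms] tree_free by (meson nle_le)

text \<open>Degeneracy of the bipartite graph between \<open>P\<close> and \<open>Q\<close>: if
  every vertex exceeded the threshold of its side, \<open>embeds_bipartite\<close> would apply to
  \<open>S\<close>.\<close>

lemma peel_bipartite:
  assumes "P \<subseteq> V" "Q \<subseteq> V" "P \<inter> Q = {}" "S \<subseteq> P \<union> Q" "S \<noteq> {}"
  shows "\<exists>v\<in>S. card {w \<in> S. (v, w) \<in> E \<inter> (P \<times> Q \<union> Q \<times> P)} \<le> (if v \<in> P then m else l)"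
proof (rule ccontr)
  assume *: "\<not> ?thesis"
  have "embeds W F V E"
  proof (rule embeds_bipartite[of E "S \<inter> P" V "S \<inter> Q"])
    show "m \<le> card {q \<in> S \<inter> Q. (p, q) \<in> E}" if p: "p \<in> S \<inter> P" for p
    proof -
      have "{w \<in> S. (p, w) \<in> E \<inter> (P \<times> Q \<union> Q \<times> P)} = {q \<in> S \<inter> Q. (p, q) \<in> E}"
        using p assms(3) by auto
      then show ?thesis using * p by force
    qed
    show "l + 1 \<le> card {p \<in> S \<inter> P. (q, p) \<in> E}" if q: "q \<in> S \<inter> Q" for q
    proof -
      have "{w \<in> S. (q, w) \<in> E \<inter> (P \<times> Q \<union> Q \<times> P)} = {p \<in> S \<inter> P. (q, p) \<in> E}"
        using q assms(3) by auto
      moreover have "q \<notin> P" using q assms(3) by auto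
      ultimately show ?thesis using * q by force
    qed
  qed (use assms sym_E in auto)
  then show False using tree_free by blast
qed

text \<open>Constant weight 1 gives the ordinary edge count; eigenvector weights are needed in
  \<open>surgery_increases\<close>.\<close>

lemma weighted_edges_le:
  fixes x :: "'b \<Rightarrow> real"
  assumes "S \<subseteq> V" "\<And>v. v \<in> S \<Longrightarrow> 0 \<le> x v" "\<And>v. v \<in> S \<Longrightarrow> x v \<le> \<eta>"
  shows "(\<Sum>v\<in>S. \<Sum>w\<in>N v \<inter> S. x v * x w) \<le> 2 * \<eta> * m * (\<Sum>v\<in>S. x v)"
proof -
  have "(\<Sum>v\<in>S. \<Sum>w\<in>{w \<in> S. (v, w) \<in> E}. x v * x w) \<le> 2 * \<eta> * (\<Sum>v\<in>S. m * x v)"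
  proof (rule peeling_sum_le)
    show "finite S" by (rule finite_sub) fact
    show "\<exists>v\<in>S'. card {w \<in> S'. (v, w) \<in> E} \<le> m" if "S' \<subseteq> S" "S' \<noteq> {}" for S'
      by (rule peel[OF order_trans[OF that(1) assms(1)] that(2)])
  qed (fact sym_E assms)+
  also have "(\<Sum>v\<in>S. m * x v) = m * (\<Sum>v\<in>S. x v)" by (rule sum_distrib_left[symmetric])
  finally show ?thesis by (simp only: N_Int[OF assms(1)] mult.assoc)
qed

lemma edges_le:
  assumes "S \<subseteq> V"
  shows "(\<Sum>v\<in>S. card (N v \<inter> S)) \<le> 2 * m * card S"
proof -
  have "real (\<Sum>v\<in>S. card (N v \<inter> S)) \<le> real (2 * m * card S)"
    using weighted_edges_le[OF assms, of "\<lambda>_. 1" 1] by simp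
  then show ?thesis by (simp only: of_nat_le_iff)
qed

lemma bipartite_edges_le:
  assumes "P \<subseteq> V" "Q \<subseteq> V" "P \<inter> Q = {}"
  shows "(\<Sum>q\<in>Q. card (N q \<inter> P)) \<le> m * card P + l * card Q"
proof -
  define E' where "E' = E \<inter> (P \<times> Q \<union> Q \<times> P)"
  let ?c = "\<lambda>v. if v \<in> P then m else l"
  have fin: "finite P" "finite Q" using assms finite_sub by auto
  have "(\<Sum>v\<in>P \<union> Q. \<Sum>w\<in>{w \<in> P \<union> Q. (v, w) \<in> E'}. 1 * 1) \<le> 2 * 1 * (\<Sum>v\<in>P \<union> Q. real (?c v) * 1)"
  proof (rule peeling_sum_le)
    show "sym E'" using sym_E by (auto simp: E'_def sym_def)
    show "\<exists>v\<in>S'. card {w \<in> S'. (v, w) \<in> E'} \<le> ?c v" if "S' \<subseteq> P \<union> Q" "S' \<noteq> {}" for S'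
      unfolding E'_def by (rule peel_bipartite[OF assms that])
  qed (use fin in auto)
  moreover have "(\<Sum>v\<in>P \<union> Q. real (?c v)) = m * card P + l * card Q"
  proof -
    have "(\<Sum>v\<in>Q. real (?c v)) = (\<Sum>v\<in>Q. real l)" using assms(3) by (intro sum.cong) auto
    then show ?thesis using fin assms(3) by (simp add: sum.union_disjoint)
  qed
  \<comment> \<open>Each edge is counted once from either side; by \<open>sum_card_swap\<close> both
    counts agree, which cancels the factor 2.\<close>
  moreover have "(\<Sum>v\<in>P \<union> Q. \<Sum>w\<in>{w \<in> P \<union> Q. (v, w) \<in> E'}. 1 * 1 :: real) =
      real (\<Sum>p\<in>P. card {q \<in> Q. (p, q) \<in> E}) + real (\<Sum>q\<in>Q. card {p \<in> P. (q, p) \<in> E})"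
  proof -
    have "{w \<in> P \<union> Q. (p, w) \<in> E'} = {q \<in> Q. (p, q) \<in> E}" if "p \<in> P" for p
      using that assms(3) by (auto simp: E'_def)
    moreover have "{w \<in> P \<union> Q. (q, w) \<in> E'} = {p \<in> P. (q, p) \<in> E}" if "q \<in> Q" for q
      using that assms(3) by (auto simp: E'_def)
    ultimately show ?thesis using fin assms(3) by (simp add: sum.union_disjoint)
  qed
  ultimately have "2 * real (\<Sum>q\<in>Q. card {p \<in> P. (q, p) \<in> E}) \<le> 2 * real (m * card P + l * card Q)"
    using sum_card_swap[OF fin sym_E] by simp
  then have "real (\<Sum>q\<in>Q. card {p \<in> P. (q, p) \<in> E}) \<le> real (m * card P + l * card Q)"
    by (rule mult_left_le_imp_le) simp
  then show ?thesis using assms(1) by (simp only: N_Int of_nat_le_iff)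
qed

text \<open>Each vertex of \<open>?Q\<close> contributes at least \<open>l + 1\<close> to a count of
  at most \<open>m * card L + l * card ?Q\<close>. Hence \<open>?Q\<close> has at most
  \<open>m * card L\<close> elements, and inserting this into the same count gives the
  claim.\<close>

lemma many_neighbours_le:
  assumes "L \<subseteq> V"
  shows "(\<Sum>q\<in>{q \<in> V - L. l < card (N q \<inter> L)}. card (N q \<inter> L)) \<le> (l + 1) * m * card L"
proof -
  let ?Q = "{q \<in> V - L. l < card (N q \<inter> L)}"
  have le: "(\<Sum>q\<in>?Q. card (N q \<inter> L)) \<le> m * card L + l * card ?Q"
    by (rule bipartite_edges_le) (use assms in auto)
  have "(l + 1) * card ?Q \<le> (\<Sum>q\<in>?Q. card (N q \<inter> L))"
    using sum_bounded_below[of ?Q "l + 1" "\<lambda>q. card (N q \<inter> L)"] by (simp add: mult.commute)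
  then have "card ?Q \<le> m * card L" using le by simp
  then have "m * card L + l * card ?Q \<le> m * card L + l * (m * card L)"
    by (intro add_left_mono mult_le_mono2)
  also have "\<dots> = (l + 1) * m * card L" by (simp add: algebra_simps)
  finally show ?thesis by (rule order_trans[OF le])
qed

text \<open>Together with \<open>m\<close> common neighbours, \<open>K\<close> would span a complete
  bipartite graph that contains the tree.\<close>

lemma common_neighbours_less:
  assumes "K \<subseteq> V" "card K = l + 1"
  shows "card {w \<in> V. K \<subseteq> N w} < m"
proof (rule ccontr)
  assume *: "\<not> ?thesis"
  let ?R = "{w \<in> V. K \<subseteq> N w}"
  have fin: "finite K" using assms finite_sub by auto
  have "embeds W F V E"
  proof (rule embeds_bipartite[of E K V ?R])
    show "K \<inter> ?R = {}" using irrefl_E by (auto simp: N_def irrefl_def)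
    show "K \<union> ?R \<noteq> {}" using assms by auto
    show "m \<le> card {q \<in> ?R. (p, q) \<in> E}" if "p \<in> K" for p
    proof -
      have "{q \<in> ?R. (p, q) \<in> E} = ?R" using that sym_E by (auto simp: N_def dest: symD)
      then show ?thesis using * by simp
    qed
    show "l + 1 \<le> card {p \<in> K. (q, p) \<in> E}" if "q \<in> ?R" for q
    proof -
      have "{p \<in> K. (q, p) \<in> E} = K" using that by (auto simp: N_def)
      then show ?thesis using assms by simp
    qed
  qed (use assms sym_E in auto)
  then show False using tree_free by blast
qed

text \<open>The comparison graph: for \<open>M\<close> contained in \<open>V\<close>, it joins
  \<open>M\<close> to every vertex outside \<open>M\<close>.\<close>

definition surgery :: "'b set \<Rightarrow> 'b rel" where
  "surgery M = (let S = V - M - {w \<in> V. M \<subseteq> N w} in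
     E \<inter> (V - S) \<times> (V - S) \<union> S \<times> M \<union> M \<times> S)"

lemma sym_surgery: "sym (surgery M)"
  using sym_E by (auto simp: surgery_def Let_def sym_def)

lemma irrefl_surgery: "irrefl (surgery M)"
  using irrefl_E by (auto simp: surgery_def Let_def irrefl_def)

lemma surgery_sub: "M \<subseteq> V \<Longrightarrow> surgery M \<subseteq> V \<times> V"
  by (auto simp: surgery_def Let_def)

lemma surgery_not_embeds:
  assumes "M \<subseteq> V" "2 * m \<le> card {w \<in> V. M \<subseteq> N w}"
  shows "\<not> embeds W F V (surgery M)"
proof
  assume "embeds W F V (surgery M)"
  then obtain f where f: "inj_on f W" "f ` W \<subseteq> V"
    and fe: "\<And>u v. (u, v) \<in> F \<Longrightarrow> (f u, f v) \<in> surgery M"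
    unfolding embeds_def by blast
  define R where "R = {w \<in> V. M \<subseteq> N w}"
  define S where "S = V - M - R"
  define D where "D = {w \<in> W. f w \<in> S}"
  have E': "surgery M = E \<inter> (V - S) \<times> (V - S) \<union> S \<times> M \<union> M \<times> S"
    unfolding surgery_def Let_def S_def R_def by (rule refl)
  have finR: "finite R" using finite_V by (simp add: R_def)
  \<comment> \<open>At most \<open>m\<close> vertices of \<open>R\<close> are occupied and at most
    \<open>m\<close> images have to move; this is where \<open>2 * m\<close> comes from.\<close>
  have "card D \<le> m" using finite_W by (auto simp: D_def intro: card_mono)
  also have "\<dots> \<le> card R - card (f ` W)"
    using assms(2) card_image[OF f(1)] by (simp add: R_def)
  also have "\<dots> \<le> card (R - f ` W)" by (rule diff_card_le_card_Diff) (simp add: finite_W)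
  finally obtain g where g: "inj_on g D" "g ` D \<subseteq> R - f ` W"
    using card_le_inj[of D "R - f ` W"] finite_W finR by (auto simp: D_def)
  define h where "h w = (if w \<in> D then g w else f w)" for w
  have "inj_on h W"
  proof (rule inj_onI)
    fix a b assume ab: "a \<in> W" "b \<in> W" "h a = h b"
    have "g c \<noteq> f d" if "c \<in> D" "d \<in> W" for c d using g(2) that by blast
    then show "a = b" using ab f(1) g(1) by (auto simp: h_def inj_on_def split: if_splits; metis)
  qed
  moreover have "h ` W \<subseteq> V" using f(2) g(2) by (auto simp: h_def R_def)
  moreover have "(h u, h v) \<in> E" if uv: "(u, v) \<in> F" for u v
  proof -
    have W: "u \<in> W" "v \<in> W" using uv F_sub W_eq by auto
    have gR: "(g w, z) \<in> E" "(z, g w) \<in> E" if "w \<in> D" "z \<in> M" for w z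
      using g(2) that sym_E by (auto simp: R_def N_def dest: symD)
    have SM: "S \<inter> M = {}" by (auto simp: S_def)
    from fe[OF uv] consider "(f u, f v) \<in> E" "f u \<notin> S" "f v \<notin> S"
      | "f u \<in> S" "f v \<in> M" | "f u \<in> M" "f v \<in> S" unfolding E' by auto
    then show ?thesis
    proof cases
      case 1
      then show ?thesis by (simp add: h_def D_def)
    next
      case 2
      then show ?thesis using SM W gR(1)[of u "f v"] by (auto simp: h_def D_def)
    next
      case 3
      then show ?thesis using SM W gR(2)[of v "f u"] by (auto simp: h_def D_def)
    qed
  qed
  ultimately have "embeds W F V E" unfolding embeds_def by blast
  then show False using tree_free by blast
qed

end

section \<open>Large entries of the principal eigenvector\<close>

text \<open>Entries of \<open>x\<close> may vanish, because the graph need not be connected.\<close>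

locale tree_free_eigenvector = tree_free W A B F l V E
  for W A B :: "'a set" and F l and V :: "'b set" and E +
  fixes x :: "'b \<Rightarrow> real" and \<Lambda> :: real
  assumes \<Lambda>_pos: "0 < \<Lambda>"
    and eig: "\<And>v. v \<in> V \<Longrightarrow> (\<Sum>w\<in>N v. x w) = \<Lambda> * x v"
    and x_nonneg: "\<And>v. 0 \<le> x v" and x_le_1: "\<And>v. v \<in> V \<Longrightarrow> x v \<le> 1"
begin

abbreviation n :: nat where "n \<equiv> card V"

lemma m_pos: "0 < m" using l_less_m by simp

lemma sum_degrees_le: "(\<Sum>v\<in>V. card (N v)) \<le> 2 * m * n"
proof -
  have "N v \<inter> V = N v" for v using N_sub by auto
  then show ?thesis using edges_le[of V] by simp
qed

text \<open>As all entries are at most 1, an entry of at least \<epsilon> forces degree at least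
  \<open>\<epsilon> * \<Lambda>\<close>, and the degree sum is at most
  \<open>2 * m * n\<close>.\<close>

lemma card_large_le:
  fixes \<epsilon> :: real
  assumes "0 \<le> \<epsilon>"
  shows "\<epsilon> * \<Lambda> * card {v \<in> V. \<epsilon> \<le> x v} \<le> 2 * m * n"
proof -
  let ?L = "{v \<in> V. \<epsilon> \<le> x v}"
  have "\<epsilon> * \<Lambda> \<le> card (N v)" if v: "v \<in> ?L" for v
  proof -
    have "\<epsilon> * \<Lambda> \<le> \<Lambda> * x v" using v \<Lambda>_pos by (simp add: mult.commute)
    also have "\<dots> = (\<Sum>w\<in>N v. x w)" using eig v by simp
    also have "\<dots> \<le> (\<Sum>w\<in>N v. 1)" using x_le_1 N_sub by (intro sum_mono) auto
    finally show ?thesis by simp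
  qed
  then have "(\<Sum>v\<in>?L. \<epsilon> * \<Lambda>) \<le> (\<Sum>v\<in>?L. real (card (N v)))" by (rule sum_mono)
  also have "\<dots> \<le> (\<Sum>v\<in>V. real (card (N v)))" using finite_V by (intro sum_mono2) auto
  also have "\<dots> \<le> 2 * m * n" using of_nat_mono[OF sum_degrees_le] by simp
  finally show ?thesis by (simp add: mult.commute)
qed

text \<open>Apply the eigenvalue equation twice and split the second step by membership in
  \<open>L\<close>. The part inside \<open>L\<close> is at most \<open>c\<close>, unless the middle
  vertex lies in \<open>L\<close> or has more than \<open>l\<close> neighbours there; edge counts
  bound these exceptions by \<open>2 * m * card L\<close> and \<open>(l + 1) * m * card L\<close>.
  The part outside \<open>L\<close> costs \<epsilon> times the degree sum.\<close>

lemma walk_bound: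
  fixes \<epsilon> c :: real
  defines "L \<equiv> {v \<in> V. \<epsilon> \<le> x v}"
  assumes "0 \<le> \<epsilon>" "0 \<le> c" "v \<in> V"
    and c: "\<And>w. w \<in> V \<Longrightarrow> card (N w \<inter> L) \<le> l \<Longrightarrow> (\<Sum>z\<in>N w \<inter> L. x z) \<le> c"
  shows "\<Lambda>\<^sup>2 * x v \<le> c * card (N v) + 2 * \<epsilon> * m * n + (l + 3) * m * card L"
proof -
  let ?Q = "{q \<in> V - L. l < card (N q \<inter> L)}"
  have LV: "L \<subseteq> V" by (auto simp: L_def)
  have finL: "finite L" using LV finite_sub by blast
  have pw: "\<Lambda> * x w \<le> c + (if w \<in> L then real (card (N w \<inter> L)) else 0)
      + (if w \<in> ?Q then real (card (N w \<inter> L)) else 0) + \<epsilon> * card (N w)" if w: "w \<in> V" for w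
  proof -
    have "\<Lambda> * x w = (\<Sum>z\<in>N w \<inter> L. x z) + (\<Sum>z\<in>N w - L. x z)"
      using eig[OF w] sum.Int_Diff[OF finite_N[of w], of x L] by simp
    moreover have "(\<Sum>z\<in>N w - L. x z) \<le> \<epsilon> * card (N w)"
    proof -
      have "(\<Sum>z\<in>N w - L. x z) \<le> (\<Sum>z\<in>N w - L. \<epsilon>)"
        using N_sub by (intro sum_mono) (fastforce simp: L_def)
      also have "\<dots> = card (N w - L) * \<epsilon>" by simp
      also have "\<dots> \<le> card (N w) * \<epsilon>"
        using \<open>0 \<le> \<epsilon>\<close> by (intro mult_right_mono of_nat_mono card_mono) auto
      finally show ?thesis by (simp add: mult.commute)
    qed
    moreover have "(\<Sum>z\<in>N w \<inter> L. x z) \<le> card (N w \<inter> L)"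
    proof -
      have "(\<Sum>z\<in>N w \<inter> L. x z) \<le> (\<Sum>z\<in>N w \<inter> L. 1)"
        using x_le_1 LV by (intro sum_mono) auto
      then show ?thesis by simp
    qed
    moreover have "(\<Sum>z\<in>N w \<inter> L. x z) \<le> c" if "w \<notin> L" "w \<notin> ?Q"
      using c[OF w] that w by auto
    ultimately show ?thesis using \<open>0 \<le> c\<close> by auto
  qed
  have "\<Lambda>\<^sup>2 * x v = (\<Sum>w\<in>N v. \<Lambda> * x w)"
    using eig[OF \<open>v \<in> V\<close>] by (simp add: power2_eq_square sum_distrib_left[symmetric])
  also have "\<dots> \<le> (\<Sum>w\<in>N v. c + (if w \<in> L then real (card (N w \<inter> L)) else 0)
      + (if w \<in> ?Q then real (card (N w \<inter> L)) else 0) + \<epsilon> * card (N w))"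
    by (intro sum_mono pw) (use N_sub in blast)
  also have "\<dots> = c * card (N v) + (\<Sum>w\<in>N v. if w \<in> L then real (card (N w \<inter> L)) else 0)
      + (\<Sum>w\<in>N v. if w \<in> ?Q then real (card (N w \<inter> L)) else 0) + (\<Sum>w\<in>N v. \<epsilon> * card (N w))"
    by (simp only: sum.distrib) (simp add: mult.commute)
  also have "\<dots> \<le> c * card (N v) + 2 * m * card L + (l + 1) * m * card L + \<epsilon> * (2 * m * n)"
  proof (intro add_mono order_refl)
    have "(\<Sum>w\<in>N v. if w \<in> L then real (card (N w \<inter> L)) else 0)
        \<le> (\<Sum>w\<in>V. if w \<in> L then real (card (N w \<inter> L)) else 0)"
      using finite_V N_sub by (intro sum_mono2) auto
    also have "\<dots> = (\<Sum>w\<in>L. real (card (N w \<inter> L)))"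
      using finite_V LV by (simp add: sum.If_cases Int_absorb1)
    also have "\<dots> \<le> 2 * m * card L" using of_nat_mono[OF edges_le[OF LV]] by simp
    finally show "(\<Sum>w\<in>N v. if w \<in> L then real (card (N w \<inter> L)) else 0) \<le> real (2 * m * card L)" by simp
    have "(\<Sum>w\<in>N v. if w \<in> ?Q then real (card (N w \<inter> L)) else 0)
        \<le> (\<Sum>w\<in>V. if w \<in> ?Q then real (card (N w \<inter> L)) else 0)"
      using finite_V N_sub by (intro sum_mono2) auto
    also have "\<dots> = (\<Sum>w\<in>?Q. real (card (N w \<inter> L)))"
      using sum.inter_restrict[OF finite_V, of "\<lambda>w. real (card (N w \<inter> L))" ?Q]
      by (simp add: Int_absorb1 subset_iff)
    also have "\<dots> = real (\<Sum>w\<in>?Q. card (N w \<inter> L))" by simp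
    also have "\<dots> \<le> real ((l + 1) * m * card L)" by (rule of_nat_mono[OF many_neighbours_le[OF LV]])
    finally show "(\<Sum>w\<in>N v. if w \<in> ?Q then real (card (N w \<inter> L)) else 0) \<le> real ((l + 1) * m * card L)" .
    have "(\<Sum>w\<in>N v. \<epsilon> * card (N w)) \<le> (\<Sum>w\<in>V. \<epsilon> * card (N w))"
      using finite_V N_sub \<open>0 \<le> \<epsilon>\<close> by (intro sum_mono2) auto
    also have "\<dots> = \<epsilon> * real (\<Sum>w\<in>V. card (N w))" by (simp add: sum_distrib_left)
    also have "\<dots> \<le> \<epsilon> * real (2 * m * n)"
      by (rule mult_left_mono[OF of_nat_mono[OF sum_degrees_le] \<open>0 \<le> \<epsilon>\<close>])
    finally show "(\<Sum>w\<in>N v. \<epsilon> * card (N w)) \<le> \<epsilon> * real (2 * m * n)" .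
  qed
  finally show ?thesis by (simp add: algebra_simps)
qed

text \<open>Each of the two error terms becomes at most \<open>e * n / 2\<close>. For the second,
  \<open>card_large_le\<close> gives \<open>card L\<close> at most 8 m^2 n / (e \<Lambda>), which
  explains the lower bound on \<Lambda>.\<close>

lemma walk_bound_asymptotic:
  fixes e c :: real
  assumes "0 < e"
  defines "L \<equiv> {v \<in> V. e / (4 * m) \<le> x v}"
  assumes "16 * (l + 3) * m ^ 3 / e\<^sup>2 \<le> \<Lambda>" "0 \<le> c" "v \<in> V"
    and "\<And>w. w \<in> V \<Longrightarrow> card (N w \<inter> L) \<le> l \<Longrightarrow> (\<Sum>z\<in>N w \<inter> L. x z) \<le> c"
  shows "\<Lambda>\<^sup>2 * x v \<le> c * card (N v) + e * n"
proof -
  define \<epsilon> where "\<epsilon> = e / (4 * m)"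
  have \<epsilon>: "0 < \<epsilon>" using \<open>0 < e\<close> m_pos by (simp add: \<epsilon>_def)
  have L: "L = {v \<in> V. \<epsilon> \<le> x v}" by (simp add: L_def \<epsilon>_def)
  have "\<Lambda>\<^sup>2 * x v \<le> c * card (N v) + 2 * \<epsilon> * m * n + (l + 3) * m * card L"
    unfolding L by (rule walk_bound) (use assms \<epsilon> L in auto)
  moreover have "2 * \<epsilon> * m = e / 2" using m_pos by (simp add: \<epsilon>_def)
  moreover have "(l + 3) * m * real (card L) \<le> e * n / 2"
  proof -
    have "\<epsilon> * \<Lambda> * card L \<le> 2 * m * n" unfolding L by (rule card_large_le) (use \<epsilon> in simp)
    then have 1: "e * \<Lambda> * card L \<le> 8 * m * m * n" using m_pos by (simp add: \<epsilon>_def field_simps)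
    have "16 * (l + 3) * m ^ 3 \<le> \<Lambda> * e\<^sup>2"
      using assms(3) \<open>0 < e\<close> by (simp add: field_simps)
    then have "real (16 * (l + 3) * m ^ 3) * card L \<le> \<Lambda> * e\<^sup>2 * card L" by (rule mult_right_mono) simp
    also have "\<dots> = e * (e * \<Lambda> * card L)" by (simp add: power2_eq_square)
    also have "\<dots> \<le> e * (8 * m * m * n)" using 1 \<open>0 < e\<close> by (intro mult_left_mono) auto
    finally have "(8 * (real m)\<^sup>2) * (2 * ((l + 3) * m * card L)) \<le> (8 * (real m)\<^sup>2) * (e * n)"
      by (simp add: power2_eq_square power3_eq_cube mult_ac)
    then have "real (2 * ((l + 3) * m * card L)) \<le> e * n"
      by (rule mult_left_le_imp_le) (use m_pos in simp)
    then show ?thesis by simp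
  qed
  ultimately show ?thesis by simp
qed

text \<open>Take \<open>c = l\<close> in the walk bound, since at most \<open>l\<close> entries of
  size at most 1 are summed, and divide by \<open>l\<close>. One \<open>e * n\<close> is the error
  term; the other absorbs the \<open>l\<close> lost in \<open>l * (n - l)\<close>.\<close>

lemma degree_bound:
  fixes e :: real
  assumes "0 < e" "16 * (l + 3) * m ^ 3 / e\<^sup>2 \<le> \<Lambda>" "1 \<le> l" "l \<le> e * n"
    and \<Lambda>: "l * (real n - l) \<le> \<Lambda>\<^sup>2" and v: "v \<in> V"
  shows "n * (x v - 2 * e) \<le> card (N v)"
proof -
  have "\<Lambda>\<^sup>2 * x v \<le> real l * card (N v) + e * n"
  proof (rule walk_bound_asymptotic)
    fix w
    let ?Z = "N w \<inter> {v \<in> V. e / (4 * m) \<le> x v}"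
    assume "card ?Z \<le> l"
    have "(\<Sum>z\<in>?Z. x z) \<le> (\<Sum>z\<in>?Z. 1)" using x_le_1 by (intro sum_mono) auto
    also have "\<dots> \<le> l" using \<open>card ?Z \<le> l\<close> by simp
    finally show "(\<Sum>z\<in>?Z. x z) \<le> l" .
  qed (use assms in auto)
  moreover have "l * (real n - l) * x v \<le> \<Lambda>\<^sup>2 * x v" by (rule mult_right_mono[OF \<Lambda> x_nonneg])
  moreover have "real l * l * x v \<le> real l * l * 1" using x_le_1[OF v] by (intro mult_left_mono) auto
  moreover have "1 * (e * n) \<le> l * (e * n)" using \<open>0 < e\<close> \<open>1 \<le> l\<close> by (intro mult_right_mono) auto
  ultimately have "l * (n * x v) \<le> l * (card (N v) + e * n + l)" by (simp add: algebra_simps)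
  then have "n * x v \<le> card (N v) + e * n + l" using \<open>1 \<le> l\<close> by simp
  then show ?thesis using \<open>l \<le> e * n\<close> by (simp add: algebra_simps)
qed

text \<open>With fewer than \<open>l\<close> such vertices, \<open>c = l - 3 * e\<close> works in
  the walk bound at \<open>u\<close>. As the degree is at most \<open>n\<close>, this gives
  \<Lambda>^2 at most l n - 2 e n, which is less than l n - l^2.\<close>

lemma many_heavy_vertices:
  fixes e :: real
  assumes "0 < e" "3 * e \<le> 1" "16 * (l + 3) * m ^ 3 / e\<^sup>2 \<le> \<Lambda>" "1 \<le> l" "real l ^ 2 < 2 * e * n"
    and \<Lambda>: "l * (real n - l) \<le> \<Lambda>\<^sup>2" and u: "u \<in> V" "x u = 1"
  shows "l \<le> card {v \<in> V. 1 - 3 * e < x v}"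
proof (rule ccontr)
  let ?M = "{v \<in> V. 1 - 3 * e < x v}"
  assume *: "\<not> ?thesis"
  have "\<Lambda>\<^sup>2 * x u \<le> (l - 3 * e) * card (N u) + e * n"
  proof (rule walk_bound_asymptotic)
    show "0 \<le> l - 3 * e" using \<open>3 * e \<le> 1\<close> \<open>1 \<le> l\<close> by simp
    fix w
    let ?Z = "N w \<inter> {v \<in> V. e / (4 * m) \<le> x v}"
    assume Z: "card ?Z \<le> l"
    \<comment> \<open>Every entry is at most \<open>1 - 3 * e\<close>, plus a correction of
      \<open>3 * e\<close> at the members of \<open>?M\<close>, of which there are at most
      \<open>l - 1\<close>.\<close>
    have "(\<Sum>z\<in>?Z. x z) \<le> (\<Sum>z\<in>?Z. (1 - 3 * e) + (if z \<in> ?M then 3 * e else 0))"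
      using x_le_1 by (intro sum_mono) auto
    also have "\<dots> = (1 - 3 * e) * card ?Z + 3 * e * card (?Z \<inter> ?M)"
    proof -
      have "(\<Sum>z\<in>?Z. if z \<in> ?M then 3 * e else 0) = (\<Sum>z\<in>?Z \<inter> ?M. 3 * e)"
        by (rule sum.inter_restrict[symmetric]) simp
      then show ?thesis by (simp only: sum.distrib) (simp add: mult.commute)
    qed
    also have "\<dots> \<le> (1 - 3 * e) * l + 3 * e * (real l - 1)"
    proof (intro add_mono mult_left_mono)
      have "card (?Z \<inter> ?M) \<le> card ?M" using finite_V by (intro card_mono) auto
      then show "real (card (?Z \<inter> ?M)) \<le> real l - 1" using * by linarith
    qed (use Z assms in auto)
    finally show "(\<Sum>z\<in>?Z. x z) \<le> l - 3 * e" by (simp add: algebra_simps)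
  qed (use assms in auto)
  also have "\<dots> \<le> (l - 3 * e) * n + e * n"
    using \<open>3 * e \<le> 1\<close> \<open>1 \<le> l\<close> card_mono[OF finite_V N_sub, of u]
    by (intro add_right_mono mult_left_mono) auto
  finally show False using \<Lambda> u assms(5) by (simp add: algebra_simps power2_eq_square)
qed

text \<open>
  The constant $e$ is chosen such that $14 e l = 1/(8m)$: the $l$ vertices of $M$ miss at most
  $5 e l n$ vertices in total, so that a further vertex with entry above $1/(8m)$ still has more
  than $7 e l n$ common neighbours with them.
\<close>

lemma heavy_vertices:
  fixes e :: real
  defines "e \<equiv> 1 / (112 * m * l)"
  assumes "16 * (l + 3) * m ^ 3 / e\<^sup>2 \<le> \<Lambda>" "1 \<le> l" "l \<le> e * n" "real l ^ 2 < 2 * e * n"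
    and n: "16 * m * m < n"
    and \<Lambda>: "l * (real n - l) \<le> \<Lambda>\<^sup>2" and u: "u \<in> V" "x u = 1"
  obtains M where "M \<subseteq> V" "card M = l" "\<And>z. z \<in> M \<Longrightarrow> 1 / 2 \<le> x z"
    "\<And>v. v \<in> V - M \<Longrightarrow> x v \<le> 1 / (8 * m)" "2 * m \<le> card {w \<in> V. M \<subseteq> N w}"
proof -
  have lm: "1 \<le> real l * real m" using \<open>1 \<le> l\<close> m_pos by (metis One_nat_def Suc_leI le_trans mult_le_mono nat_mult_1 of_nat_1 of_nat_le_iff of_nat_mult)
  have e: "0 < e" "6 * e \<le> 1" using lm m_pos \<open>1 \<le> l\<close> by (auto simp: e_def field_simps)
  have el: "14 * e * l = 1 / (8 * m)" using m_pos \<open>1 \<le> l\<close> by (simp add: e_def field_simps)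
  have e3: "3 * e \<le> 1" using e by simp
  have "l \<le> card {v \<in> V. 1 - 3 * e < x v}"
    by (rule many_heavy_vertices[OF e(1) e3 assms(2,3,5) \<Lambda> u])
  then obtain M where M: "M \<subseteq> {v \<in> V. 1 - 3 * e < x v}" "card M = l"
    by (meson obtain_subset_with_card_n)
  have MV: "M \<subseteq> V" using M by auto
  have finM: "finite M" using MV finite_sub by blast
  have deg: "n * (x v - 2 * e) \<le> card (N v)" if "v \<in> V" for v
    by (rule degree_bound[OF e(1) assms(2-4) \<Lambda> that])
  define R where "R = {w \<in> V. M \<subseteq> N w}"
  have RV: "R \<subseteq> V" by (auto simp: R_def)
  have finR: "finite R" using RV finite_sub by blast
  have "V - R \<subseteq> (\<Union>z\<in>M. V - N z)"
    using sym_E MV by (auto simp: R_def N_def dest: symD)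
  then have "card (V - R) \<le> card (\<Union>z\<in>M. V - N z)"
    using finite_V finM by (intro card_mono) auto
  also have "\<dots> \<le> (\<Sum>z\<in>M. card (V - N z))" by (rule card_UN_le) fact
  finally have "real (card (V - R)) \<le> (\<Sum>z\<in>M. real (card (V - N z)))" by (simp add: of_nat_mono flip: of_nat_sum)
  also have "\<dots> \<le> (\<Sum>z\<in>M. n * (5 * e))"
  proof (rule sum_mono)
    fix z assume z: "z \<in> M"
    \<comment> \<open>An entry above \<open>1 - 3 * e\<close> loses another \<open>2 * e\<close> in
      the degree bound, so \<open>z\<close> misses at most \<open>5 * e * n\<close>
      vertices.\<close>
    have "n * (1 - 5 * e) \<le> n * (x z - 2 * e)" using z M(1) by (intro mult_left_mono) auto
    also have "\<dots> \<le> card (N z)" using deg z MV by auto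
    finally have "n * (1 - 5 * e) \<le> card (N z)" .
    moreover have "real (card (V - N z)) = real n - card (N z)"
      using card_Diff_subset[OF finite_N N_sub, of z] card_mono[OF finite_V N_sub, of z] by simp
    ultimately show "real (card (V - N z)) \<le> n * (5 * e)" by (simp add: algebra_simps)
  qed
  also have "\<dots> = 5 * e * l * n" using M(2) by simp
  finally have VR: "real (card (V - R)) \<le> 5 * e * l * n" .
  show thesis
  proof (rule that[OF MV M(2)])
    show "1 / 2 \<le> x z" if "z \<in> M" for z
    proof -
      have "1 - 3 * e < x z" using that M(1) by auto
      then show ?thesis using e by linarith
    qed
    show "2 * m \<le> card {w \<in> V. M \<subseteq> N w}"
    proof -
      have "real n = card R + card (V - R)"
        using card_Diff_subset[OF finR RV] card_mono[OF finite_V RV] by simp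
      moreover have "5 * e * l * n \<le> 1 / 2 * n"
      proof (rule mult_right_mono)
        have "1 / (8 * real m) \<le> 1 / 8" using m_pos by (simp add: field_simps)
        then show "5 * e * l \<le> 1 / 2" using el by linarith
      qed simp
      moreover have "16 * real m \<le> n"
      proof -
        have "16 * m * 1 \<le> 16 * m * m" using m_pos by (intro mult_le_mono2) simp
        then show ?thesis using n by linarith
      qed
      ultimately have "2 * real m \<le> card R" using VR by linarith
      then show ?thesis by (simp add: R_def)
    qed
    show "x v \<le> 1 / (8 * m)" if v: "v \<in> V - M" for v
    proof (rule ccontr)
      assume nv: "\<not> ?thesis"
      have "n * (1 / (8 * m) - 2 * e) \<le> n * (x v - 2 * e)" using nv by (intro mult_left_mono) auto
      also have "\<dots> \<le> card (N v)" using deg v by auto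
      also have "\<dots> \<le> card (N v \<inter> R) + real (card (V - R))"
      proof -
        have "card (N v) \<le> card ((N v \<inter> R) \<union> (V - R))"
          using finite_V N_sub by (intro card_mono) auto
        also have "\<dots> \<le> card (N v \<inter> R) + card (V - R)" by (rule card_Un_le)
        finally show ?thesis by (simp flip: of_nat_add)
      qed
      also have "card (N v \<inter> R) \<le> real m"
      proof -
        have "card {w \<in> V. insert v M \<subseteq> N w} < m"
          by (rule common_neighbours_less) (use v MV M(2) finM in auto)
        moreover have "{w \<in> V. insert v M \<subseteq> N w} = N v \<inter> R"
          using v sym_E by (auto simp: R_def N_def dest: symD)
        ultimately show ?thesis by simp
      qed
      finally have "n * (1 / (8 * m) - 2 * e) \<le> m + 5 * e * l * n" using VR by linarith
      moreover have "2 * e * n \<le> 2 * e * l * n"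
        using e \<open>1 \<le> l\<close> by (intro mult_right_mono) auto
      moreover have "n * (1 / (8 * m)) = 14 * e * l * n" using el by simp
      \<comment> \<open>Here 14 - 2 - 5 = 7: the degree of \<open>v\<close> loses
        \<open>2 * e * l * n\<close> at most by the degree bound and \<open>5 * e * l * n\<close>
        outside \<open>R\<close>. Since \<open>7 * e * l\<close> is 1/(16 m), \<open>n\<close> is at
        most 16 m^2, a contradiction.\<close>
      ultimately have "7 * e * l * n \<le> m" by (simp add: algebra_simps)
      moreover have "7 * e * l * n = n / (16 * m)"
      proof -
        have "7 * e * l = 1 / (16 * m)" using el by simp
        then show ?thesis by simp
      qed
      ultimately have "n / (16 * m) \<le> real m" by linarith
      then have "real n \<le> 16 * m * m" using m_pos by (simp add: field_simps)
      then show False using n by (metis of_nat_le_iff of_nat_mult of_nat_numeral not_le)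
    qed
  qed
qed

text \<open>
  The test vector takes the value $a/\<Lambda>$, where $a$ is the sum of $x$ over $M$, on the reattached
  vertices. This maximises their contribution $2 a y - \<Lambda> y^2$, so the gain is strict even
  where $x$ vanishes.
\<close>

lemma surgery_increases:
  assumes "1 \<le> l" and M: "M \<subseteq> V" "card M = l" "\<And>z. z \<in> M \<Longrightarrow> 1 / 2 \<le> x z"
    and light: "\<And>v. v \<in> V - M \<Longrightarrow> x v \<le> 1 / (8 * m)"
    and ne: "V - M - {w \<in> V. M \<subseteq> N w} \<noteq> {}"
  shows "\<exists>y. \<Lambda> * (\<Sum>v\<in>V. (y v)\<^sup>2) < (\<Sum>v\<in>V. \<Sum>w\<in>{w \<in> V. (v, w) \<in> surgery M}. y v * y w)"
proof -
  define R where "R = {w \<in> V. M \<subseteq> N w}"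
  define S where "S = V - M - R"
  define U where "U = V - S"
  define a where "a = (\<Sum>z\<in>M. x z)"
  define y where "y v = (if v \<in> S then a / \<Lambda> else x v)" for v
  have E': "surgery M = E \<inter> U \<times> U \<union> S \<times> M \<union> M \<times> S"
    unfolding surgery_def Let_def S_def R_def U_def by (rule refl)
  have "S \<noteq> {}" using ne by (simp add: S_def R_def)
  have sub: "S \<subseteq> V" "U \<subseteq> V" "R \<subseteq> V" and V: "V = U \<union> S" and US: "U \<inter> S = {}" and MU: "M \<subseteq> U"
    using M(1) by (auto simp: S_def U_def R_def)
  have UMR: "U \<subseteq> M \<union> R" by (auto simp: U_def S_def)
  have RM: "R \<inter> M = {}" using irrefl_E by (auto simp: R_def N_def irrefl_def)
  have fin: "finite S" "finite U" "finite M" "finite R" using sub M(1) finite_sub by auto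
  have NS: "(\<Sum>w\<in>N v. f w) = (\<Sum>w\<in>N v \<inter> U. f w) + (\<Sum>w\<in>N v \<inter> S. f w)" for v and f :: "'b \<Rightarrow> real"
  proof -
    have "N v = (N v \<inter> U) \<union> (N v \<inter> S)" using N_sub V by auto
    moreover have "(N v \<inter> U) \<inter> (N v \<inter> S) = {}" using US by auto
    ultimately show ?thesis by (metis finite_N finite_Int sum.union_disjoint)
  qed
  \<comment> \<open>The quadratic form of the old graph at \<open>x\<close> is D + 2X + Y; that of
    the new graph at \<open>y\<close> is D + 2 |S| a^2 / \<Lambda>.\<close>
  define D where "D = (\<Sum>v\<in>U. \<Sum>w\<in>N v \<inter> U. x v * x w)"
  define X where "X = (\<Sum>v\<in>S. \<Sum>w\<in>N v \<inter> U. x v * x w)"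
  define Y where "Y = (\<Sum>v\<in>S. \<Sum>w\<in>N v \<inter> S. x v * x w)"
  have sq: "\<Lambda> * (x v)\<^sup>2 = (\<Sum>w\<in>N v \<inter> U. x v * x w) + (\<Sum>w\<in>N v \<inter> S. x v * x w)" if "v \<in> V" for v
  proof -
    have "\<Lambda> * (x v)\<^sup>2 = x v * (\<Sum>w\<in>N v. x w)" using eig[OF that] by (simp add: power2_eq_square)
    then show ?thesis by (simp add: NS sum_distrib_left distrib_left)
  qed
  have X': "(\<Sum>v\<in>U. \<Sum>w\<in>N v \<inter> S. x v * x w) = X"
  proof -
    have "(\<Sum>v\<in>U. \<Sum>w\<in>N v \<inter> S. x v * x w) = (\<Sum>v\<in>U. \<Sum>w | w \<in> S \<and> (v, w) \<in> E. x v * x w)"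
      by (simp only: N_Int[OF sub(1)])
    also have "\<dots> = (\<Sum>w\<in>S. \<Sum>v | v \<in> U \<and> (v, w) \<in> E. x v * x w)"
      by (rule sum.swap_restrict) (use fin in auto)
    also have "\<dots> = X"
      unfolding X_def using sym_E sub(2) by (intro sum.cong) (auto simp: N_def mult.commute dest: symD)
    finally show ?thesis .
  qed
  have DU: "\<Lambda> * (\<Sum>v\<in>U. (x v)\<^sup>2) = D + X"
  proof -
    have "\<Lambda> * (\<Sum>v\<in>U. (x v)\<^sup>2) = (\<Sum>v\<in>U. (\<Sum>w\<in>N v \<inter> U. x v * x w) + (\<Sum>w\<in>N v \<inter> S. x v * x w))"
      unfolding sum_distrib_left using sub(2) by (intro sum.cong refl sq) auto
    then show ?thesis using X' by (simp add: sum.distrib D_def)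
  qed
  have XY: "\<Lambda> * (\<Sum>v\<in>S. (x v)\<^sup>2) = X + Y"
  proof -
    have "\<Lambda> * (\<Sum>v\<in>S. (x v)\<^sup>2) = (\<Sum>v\<in>S. (\<Sum>w\<in>N v \<inter> U. x v * x w) + (\<Sum>w\<in>N v \<inter> S. x v * x w))"
      unfolding sum_distrib_left using sub(1) by (intro sum.cong refl sq) auto
    then show ?thesis by (simp add: sum.distrib X_def Y_def)
  qed
  have a_ge: "1 / 2 \<le> a"
  proof -
    have "(\<Sum>z\<in>M. 1 / 2) \<le> a" unfolding a_def using M(3) by (rule sum_mono)
    then show ?thesis using M(2) \<open>1 \<le> l\<close> by simp
  qed
  \<comment> \<open>A vertex of \<open>S\<close> misses some vertex of \<open>M\<close>, losing at
    least 1/2 from \<open>a\<close>. It has at most \<open>m\<close> neighbours in \<open>R\<close>,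
    each of weight at most 1/(8 m), which give back at most 1/8.\<close>
  have X_le: "X \<le> (\<Sum>s\<in>S. x s * (a - 3 / 8))"
    unfolding X_def sum_distrib_left[symmetric]
  proof (intro sum_mono mult_left_mono x_nonneg)
    fix s assume s: "s \<in> S"
    then have sV: "s \<in> V" "s \<notin> M" "s \<notin> R" by (auto simp: S_def)
    then obtain z where z: "z \<in> M" "z \<notin> N s" by (auto simp: R_def)
    have "(\<Sum>w\<in>N s \<inter> U. x w) \<le> (\<Sum>w\<in>(M - {z}) \<union> (N s \<inter> R). x w)"
      using fin x_nonneg UMR z by (intro sum_mono2) auto
    also have "\<dots> = (\<Sum>w\<in>M - {z}. x w) + (\<Sum>w\<in>N s \<inter> R. x w)"
      using fin RM by (intro sum.union_disjoint) auto
    also have "(\<Sum>w\<in>M - {z}. x w) \<le> a - 1 / 2"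
      using M(3)[OF z(1)] fin z(1) by (simp add: a_def sum_diff1)
    also have "(\<Sum>w\<in>N s \<inter> R. x w) \<le> 1 / 8"
    proof -
      have "card {w \<in> V. insert s M \<subseteq> N w} < m"
        by (rule common_neighbours_less) (use sV M fin in auto)
      moreover have "{w \<in> V. insert s M \<subseteq> N w} = N s \<inter> R"
        using sV sym_E by (auto simp: R_def N_def dest: symD)
      ultimately have c: "card (N s \<inter> R) \<le> m" by simp
      have "(\<Sum>w\<in>N s \<inter> R. x w) \<le> (\<Sum>w\<in>N s \<inter> R. 1 / (8 * m))"
      proof (rule sum_mono)
        fix w assume "w \<in> N s \<inter> R"
        then have "w \<in> V - M" using sub(3) RM by auto
        then show "x w \<le> 1 / (8 * m)" by (rule light)
      qed
      also have "\<dots> \<le> m * (1 / (8 * m))" using c by (simp add: divide_right_mono)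
      also have "\<dots> = 1 / 8" using m_pos by simp
      finally show ?thesis .
    qed
    finally show "(\<Sum>w\<in>N s \<inter> U. x w) \<le> a - 3 / 8" by simp
  qed
  have Y_le: "Y \<le> (\<Sum>s\<in>S. x s * (1 / 4))"
  proof -
    have "Y \<le> 2 * (1 / (8 * m)) * m * (\<Sum>v\<in>S. x v)"
      unfolding Y_def by (rule weighted_edges_le) (use sub x_nonneg light in \<open>auto simp: S_def\<close>)
    then show ?thesis using m_pos unfolding sum_distrib_right[symmetric] by simp
  qed
  \<comment> \<open>Adding the vanishing quantity X + Y - \<Lambda> (sum of squares over
    \<open>S\<close>) leaves a concave quadratic in each entry \<open>x s\<close>.\<close>
  have "X = 2 * X + Y - \<Lambda> * (\<Sum>s\<in>S. (x s)\<^sup>2)" using XY by simp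
  also have "\<dots> \<le> 2 * (\<Sum>s\<in>S. x s * (a - 3 / 8)) + (\<Sum>s\<in>S. x s * (1 / 4)) - \<Lambda> * (\<Sum>s\<in>S. (x s)\<^sup>2)"
    using X_le Y_le by simp
  also have "\<dots> = (\<Sum>s\<in>S. 2 * (x s * (a - 3 / 8)) + x s * (1 / 4) - \<Lambda> * (x s)\<^sup>2)"
    by (simp only: sum.distrib sum_subtractf sum_distrib_left)
  also have "\<dots> < (\<Sum>s\<in>S. a\<^sup>2 / \<Lambda>)"
  proof (rule sum_strict_mono)
    fix s
    \<comment> \<open>Completing the square: the linear coefficient 2 (a - 3/8) + 1/4 equals 2 (a -
      1/4), so the maximum is (a - 1/4)^2 / \<Lambda>.\<close>
    have "0 \<le> (\<Lambda> * x s - (a - 1 / 4))\<^sup>2" by simp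
    then have "\<Lambda> * (2 * (x s * (a - 3 / 8)) + x s * (1 / 4) - \<Lambda> * (x s)\<^sup>2) \<le> (a - 1 / 4)\<^sup>2"
      by (simp add: power2_eq_square algebra_simps)
    also have "\<dots> < a\<^sup>2" using a_ge by (intro power_strict_mono) auto
    finally show "2 * (x s * (a - 3 / 8)) + x s * (1 / 4) - \<Lambda> * (x s)\<^sup>2 < a\<^sup>2 / \<Lambda>"
      using \<Lambda>_pos by (simp add: field_simps)
  qed (use fin \<open>S \<noteq> {}\<close> in auto)
  finally have X_less: "X < card S * (a\<^sup>2 / \<Lambda>)" by simp
  have "\<Lambda> * (\<Sum>v\<in>V. (y v)\<^sup>2) = \<Lambda> * (\<Sum>v\<in>U. (x v)\<^sup>2) + card S * (a\<^sup>2 / \<Lambda>)"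
  proof -
    have "(\<Sum>v\<in>U. (y v)\<^sup>2) = (\<Sum>v\<in>U. (x v)\<^sup>2)" using US by (intro sum.cong) (auto simp: y_def)
    moreover have "\<Lambda> * (\<Sum>v\<in>S. (y v)\<^sup>2) = card S * (a\<^sup>2 / \<Lambda>)"
      using \<Lambda>_pos by (simp add: y_def power_divide power2_eq_square)
    ultimately show ?thesis using fin US by (simp add: V sum.union_disjoint distrib_left)
  qed
  also have "\<dots> < D + 2 * (card S * (a\<^sup>2 / \<Lambda>))" using X_less unfolding DU mult_2 add.assoc by (intro add_strict_left_mono add_strict_right_mono)
  also have "\<dots> = (\<Sum>v\<in>V. \<Sum>w\<in>{w \<in> V. (v, w) \<in> surgery M}. y v * y w)"
  proof -
    have 1: "(\<Sum>w\<in>{w \<in> V. (v, w) \<in> surgery M}. y v * y w) = a / \<Lambda> * a" if "v \<in> S" for v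
    proof -
      have "{w \<in> V. (v, w) \<in> surgery M} = M" using that US MU M(1) unfolding E' by auto
      moreover have "(\<Sum>w\<in>M. y v * y w) = (\<Sum>w\<in>M. a / \<Lambda> * x w)"
        using that US MU by (intro sum.cong) (auto simp: y_def)
      ultimately show ?thesis by (simp add: a_def sum_distrib_left)
    qed
    have 2: "(\<Sum>w\<in>{w \<in> V. (v, w) \<in> surgery M}. y v * y w) =
        (\<Sum>w\<in>N v \<inter> U. x v * x w) + (if v \<in> M then x v * (card S * (a / \<Lambda>)) else 0)" if v: "v \<in> U" for v
    proof -
      have "{w \<in> V. (v, w) \<in> surgery M} = (N v \<inter> U) \<union> (if v \<in> M then S else {})"
        using v US MU sub unfolding E' by (auto simp: N_def)
      moreover have "(\<Sum>w\<in>N v \<inter> U. y v * y w) = (\<Sum>w\<in>N v \<inter> U. x v * x w)"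
        using v US by (intro sum.cong) (auto simp: y_def)
      moreover have "(\<Sum>w\<in>S. y v * y w) = x v * (card S * (a / \<Lambda>))"
      proof -
        have "(\<Sum>w\<in>S. y v * y w) = (\<Sum>w\<in>S. x v * (a / \<Lambda>))"
          using v US by (intro sum.cong) (auto simp: y_def)
        then show ?thesis by simp
      qed
      moreover have "(N v \<inter> U) \<inter> S = {}" using US by auto
      ultimately show ?thesis using fin by (simp add: sum.union_disjoint)
    qed
    have "(\<Sum>v\<in>U. if v \<in> M then x v * (card S * (a / \<Lambda>)) else 0) = card S * (a\<^sup>2 / \<Lambda>)"
    proof -
      have "(\<Sum>v\<in>U. if v \<in> M then x v * (card S * (a / \<Lambda>)) else 0) = (\<Sum>v\<in>M. x v * (card S * (a / \<Lambda>)))"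
        using fin MU by (simp add: sum.inter_restrict[symmetric] Int_absorb1)
      also have "\<dots> = a * (card S * (a / \<Lambda>))" by (simp only: a_def sum_distrib_right)
      finally show ?thesis by (simp add: power2_eq_square)
    qed
    then have "(\<Sum>v\<in>U. \<Sum>w\<in>{w \<in> V. (v, w) \<in> surgery M}. y v * y w) = D + card S * (a\<^sup>2 / \<Lambda>)"
      by (simp add: 2 sum.distrib D_def)
    moreover have "(\<Sum>v\<in>S. \<Sum>w\<in>{w \<in> V. (v, w) \<in> surgery M}. y v * y w) = card S * (a\<^sup>2 / \<Lambda>)"
      by (simp add: 1 power2_eq_square)
    ultimately show ?thesis
      using sum.union_disjoint[OF fin(2,1) US, of "\<lambda>v. \<Sum>w\<in>{w \<in> V. (v, w) \<in> surgery M}. y v * y w"]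
      unfolding V[symmetric] by simp
  qed
  finally show ?thesis by blast
qed

end

section \<open>The largest eigenvalue as a Rayleigh quotient\<close>

text \<open>The first-order condition at a maximum; for small \<open>t\<close> of the sign of
  \<open>d\<close> the linear term dominates.\<close>

lemma zero_if_quadratic_nonpos:
  fixes d b :: real
  assumes "\<And>t. 2 * t * d + t\<^sup>2 * b \<le> 0"
  shows "d = 0"
proof (rule ccontr)
  assume "d \<noteq> 0"
  define s where "s = \<bar>b\<bar> + 1"
  have s: "s > 0" "2 * s + b > 0" by (auto simp: s_def)
  have "2 * (d / s) * d + (d / s)\<^sup>2 * b = d\<^sup>2 * (2 * s + b) / s\<^sup>2"
    using s(1) by (simp add: field_simps power2_eq_square)
  moreover have "\<dots> > 0" using s \<open>d \<noteq> 0\<close> by simp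
  ultimately show False using assms[of "d / s"] by linarith
qed

text \<open>Maximise the quadratic form over nonnegative unit vectors. As the matrix is nonnegative,
  passing to absolute values shows that the maximum bounds the form on all vectors, and variation
  around the maximiser gives the eigenvalue equation.\<close>

lemma perron_eigenvector:
  fixes A :: "nat \<Rightarrow> nat \<Rightarrow> real"
  assumes sym: "\<And>i j. A i j = A j i" and nonneg: "\<And>i j. 0 \<le> A i j" and "0 < n"
  obtains x \<mu> where "\<And>i. 0 \<le> x i" "\<exists>i<n. x i \<noteq> 0"
    "\<And>i. i < n \<Longrightarrow> (\<Sum>j<n. A i j * x j) = \<mu> * x i"
    "\<And>y. (\<Sum>i<n. \<Sum>j<n. A i j * y i * y j) \<le> \<mu> * (\<Sum>i<n. (y i)\<^sup>2)"
proof -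
  define B where "B u v = (\<Sum>i<n. \<Sum>j<n. A i j * u i * v j)" for u v :: "nat \<Rightarrow> real"
  define N where "N u = (\<Sum>i<n. (u i)\<^sup>2)" for u :: "nat \<Rightarrow> real"
  \<comment> \<open>Vectors are functions on all naturals; fixing the coordinates from
    \<open>n\<close> on at 0 makes \<open>C\<close> a product of compact sets. Entries of unit
    vectors are at most 1 in absolute value, so the interval is no restriction.\<close>
  define C where "C = (\<Pi>\<^sub>E i\<in>UNIV. if i < n then {0..1::real} else {0})"
  define K where "K = C \<inter> {x. N x = 1}"
  have "compactin (product_topology (\<lambda>_. euclidean) UNIV) C"
    unfolding C_def by (subst compactin_PiE) auto
  then have "compact C" by (simp add: euclidean_product_topology)
  moreover have contN: "continuous_on UNIV N"
    unfolding N_def by (intro continuous_intros continuous_on_product_coordinates)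
  then have "closed {x. N x = 1}" by (intro closed_Collect_eq) (auto intro: continuous_intros)
  ultimately have "compact K" unfolding K_def by (rule compact_Int_closed)
  moreover have "(\<lambda>i. if i = 0 then 1 else 0) \<in> K"
    using \<open>0 < n\<close> by (auto simp: K_def C_def N_def if_distrib[of "\<lambda>x. x\<^sup>2"] cong: if_cong)
  then have "K \<noteq> {}" by blast
  moreover have "continuous_on K (\<lambda>x. B x x)"
    unfolding B_def by (intro continuous_intros continuous_on_subset[OF continuous_on_product_coordinates]) auto
  ultimately obtain x where x: "x \<in> K" and mx: "\<And>y. y \<in> K \<Longrightarrow> B y y \<le> B x x"
    using continuous_attains_sup[of K "\<lambda>x. B x x"] by blast
  define \<mu> where "\<mu> = B x x"
  have N1: "N x = 1" using x by (simp add: K_def)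
  have x0: "0 \<le> x i" for i using x by (auto simp: K_def C_def PiE_def Pi_def split: if_splits dest: spec[of _ i])
  have scale: "B (\<lambda>i. c * y i) (\<lambda>i. c * y i) = c\<^sup>2 * B y y" "N (\<lambda>i. c * y i) = c\<^sup>2 * N y" for c y
    by (simp_all add: B_def N_def sum_distrib_left power2_eq_square mult_ac)
  have ray: "B y y \<le> \<mu> * N y" for y
  proof (cases "N y = 0")
    case True
    then have "\<forall>i<n. y i = 0" by (simp add: N_def sum_nonneg_eq_0_iff)
    then have "B y y = 0" by (simp add: B_def)
    then show ?thesis using True by simp
  next
    case False
    then have Np: "N y > 0" by (simp add: N_def order_less_le sum_nonneg)
    define c where "c = 1 / sqrt (N y)"
    have c: "c > 0" "c\<^sup>2 * N y = 1" using Np by (simp_all add: c_def power_divide)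
    define z where "z i = c * (if i < n then \<bar>y i\<bar> else 0)" for i
    have Nz: "N z = 1"
      unfolding z_def scale using c(2) by (simp add: N_def)
    have zi: "0 \<le> z i" "z i \<le> 1" "i \<ge> n \<Longrightarrow> z i = 0" for i
    proof -
      show "0 \<le> z i" using c by (simp add: z_def)
      show "i \<ge> n \<Longrightarrow> z i = 0" by (simp add: z_def)
      show "z i \<le> 1"
      proof (cases "i < n")
        case True
        then have "(z i)\<^sup>2 \<le> N z" unfolding N_def by (intro member_le_sum) auto
        then show ?thesis using Nz abs_square_le_1[of "z i"] by simp
      qed (simp add: z_def)
    qed
    have "z \<in> K" using Nz zi by (auto simp: K_def C_def)
    have "c\<^sup>2 * B y y \<le> B z z"
    proof -
      have "B y y \<le> B (\<lambda>i. if i < n then \<bar>y i\<bar> else 0) (\<lambda>i. if i < n then \<bar>y i\<bar> else 0)"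
        unfolding B_def
        by (intro sum_mono) (use nonneg in \<open>auto simp: mult.assoc abs_mult[symmetric] intro: mult_left_mono\<close>)
      then show ?thesis unfolding z_def scale by (simp add: mult_left_mono)
    qed
    also have "\<dots> \<le> \<mu>" unfolding \<mu>_def by (rule mx) fact
    finally have "c\<^sup>2 * B y y \<le> c\<^sup>2 * (\<mu> * N y)" using c(2) by (simp add: mult_ac)
    then show ?thesis using c(1) by simp
  qed
  have "(\<Sum>j<n. A i j * x j) = \<mu> * x i" if i: "i < n" for i
  proof -
    define e where "e j = (if j = i then 1 else 0 :: real)" for j
    have Be: "B e v = (\<Sum>j<n. A i j * v j)" for v
    proof -
      have "B e v = (\<Sum>k<n. if k = i then (\<Sum>j<n. A i j * v j) else 0)"
        unfolding B_def e_def by (intro sum.cong) auto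
      then show ?thesis using i by simp
    qed
    have Bsym: "B u v = B v u" for u v
      unfolding B_def by (subst sum.swap) (simp add: sym mult_ac)
    \<comment> \<open>The Rayleigh bound at \<open>x + t * e\<close>, expanded in \<open>t\<close>;
      equality at \<open>t = 0\<close> removes the constant term.\<close>
    have "2 * t * (B e x - \<mu> * x i) + t\<^sup>2 * (B e e - \<mu>) \<le> 0" for t
    proof -
      have "B (\<lambda>j. x j + t * e j) (\<lambda>j. x j + t * e j) = B x x + t * B x e + t * B e x + t\<^sup>2 * B e e"
        by (simp add: B_def algebra_simps sum.distrib sum_distrib_left power2_eq_square)
      moreover have "N (\<lambda>j. x j + t * e j) = N x + 2 * t * x i + t\<^sup>2"
      proof -
        have "N (\<lambda>j. x j + t * e j) = (\<Sum>j<n. (x j)\<^sup>2 + (if j = i then 2 * t * x i + t\<^sup>2 else 0))"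
          unfolding N_def e_def by (intro sum.cong) (auto simp: power2_sum)
        then show ?thesis using i by (simp add: sum.distrib N_def)
      qed
      ultimately show ?thesis
        using ray[of "\<lambda>j. x j + t * e j"] N1 by (simp add: Bsym[of x e] \<mu>_def algebra_simps)
    qed
    then have "B e x - \<mu> * x i = 0" by (rule zero_if_quadratic_nonpos)
    then show ?thesis by (simp add: Be)
  qed
  moreover have "\<exists>i<n. x i \<noteq> 0"
  proof (rule ccontr)
    assume "\<not> (\<exists>i<n. x i \<noteq> 0)"
    then show False using N1 by (simp add: N_def)
  qed
  ultimately show thesis using that[of x \<mu>] x0 ray by (simp add: B_def N_def)
qed

text \<open>The maximiser shows that \<mu> is an eigenvalue, and the Rayleigh bound at an
  eigenvector of any other one shows that \<mu> is the largest. Finiteness of the spectrum, needed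
  for \<open>Max\<close>, comes from the characteristic polynomial.\<close>

lemma largest_eigenvalue_perron:
  assumes "G \<in> graphs_on n" "0 < n"
  defines "\<Lambda> \<equiv> largest_eigenvalue G" and "V \<equiv> {..<n}" and "E \<equiv> parcs G"
  obtains x where "\<And>v. 0 \<le> x v" "\<exists>v\<in>V. x v \<noteq> 0"
    "\<And>v. v \<in> V \<Longrightarrow> (\<Sum>w\<in>{w \<in> V. (v, w) \<in> E}. x w) = \<Lambda> * x v"
    "\<And>y. (\<Sum>v\<in>V. \<Sum>w\<in>{w \<in> V. (v, w) \<in> E}. y v * y w) \<le> \<Lambda> * (\<Sum>v\<in>V. (y v)\<^sup>2)"
proof -
  interpret pair_graph G using assms(1) by (simp add: graphs_on_def)
  have pv: "pverts G = {..<n}" using assms(1) by (simp add: graphs_on_def)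
  define A where "A i j = (if (i, j) \<in> E then 1 else 0 :: real)" for i j
  have "A i j = A j i" for i j using arcs_symmetric by (auto simp: A_def E_def)
  moreover have "0 \<le> A i j" for i j by (simp add: A_def)
  ultimately obtain x \<mu> where x: "\<And>i. 0 \<le> x i" "\<exists>i<n. x i \<noteq> 0"
    and eig: "\<And>i. i < n \<Longrightarrow> (\<Sum>j<n. A i j * x j) = \<mu> * x i"
    and ray: "\<And>y. (\<Sum>i<n. \<Sum>j<n. A i j * y i * y j) \<le> \<mu> * (\<Sum>i<n. (y i)\<^sup>2)"
    using perron_eigenvector[of A n] \<open>0 < n\<close> by blast
  let ?M = "adj_matrix G"
  have M: "?M \<in> carrier_mat n n" and Mij: "\<And>i j. i < n \<Longrightarrow> j < n \<Longrightarrow> ?M $$ (i, j) = A i j"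
    by (auto simp: adj_matrix_def pv A_def E_def)
  have Mv: "(?M *\<^sub>v v) $ i = (\<Sum>j<n. A i j * v $ j)" if "i < n" "v \<in> carrier_vec n" for i v
  proof -
    have "(?M *\<^sub>v v) $ i = (\<Sum>j\<in>{0..<n}. row ?M i $ j * v $ j)"
      using M that by (simp add: scalar_prod_def)
    also have "\<dots> = (\<Sum>j<n. A i j * v $ j)"
      using M that Mij by (intro sum.cong) auto
    finally show ?thesis .
  qed
  have le: "k \<le> \<mu>" if "eigenvalue ?M k" for k
  proof -
    obtain v where v: "v \<in> carrier_vec n" "v \<noteq> 0\<^sub>v n" "?M *\<^sub>v v = k \<cdot>\<^sub>v v"
      using \<open>eigenvalue ?M k\<close> M unfolding eigenvalue_def eigenvector_def by auto
    have kv: "(\<Sum>j<n. A i j * v $ j) = k * v $ i" if "i < n" for i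
      using Mv[OF that v(1)] v that by simp
    have "(\<Sum>i<n. \<Sum>j<n. A i j * v $ i * v $ j) = (\<Sum>i<n. v $ i * (\<Sum>j<n. A i j * v $ j))"
      by (simp add: sum_distrib_left mult_ac)
    also have "\<dots> = k * (\<Sum>i<n. (v $ i)\<^sup>2)"
      by (simp add: kv sum_distrib_left power2_eq_square mult_ac)
    finally have le: "k * (\<Sum>i<n. (v $ i)\<^sup>2) \<le> \<mu> * (\<Sum>i<n. (v $ i)\<^sup>2)" using ray[of "\<lambda>i. v $ i"] by simp
    have "\<exists>i<n. v $ i \<noteq> 0" using v(1,2) by (metis carrier_vecD eq_vecI index_zero_vec)
    then have "(\<Sum>i<n. (v $ i)\<^sup>2) > 0" by (auto intro: sum_pos2)
    then show ?thesis using le by simp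
  qed
  have "eigenvalue ?M \<mu>"
    unfolding eigenvalue_def eigenvector_def
  proof (intro exI[of _ "vec n x"] conjI)
    show "vec n x \<in> carrier_vec (dim_row ?M)" using M by simp
    show "vec n x \<noteq> 0\<^sub>v (dim_row ?M)" using M x(2) by (auto simp: vec_eq_iff)
    show "?M *\<^sub>v vec n x = \<mu> \<cdot>\<^sub>v vec n x"
      using M eig by (intro eq_vecI) (auto simp del: index_mult_mat_vec simp: Mv)
  qed
  moreover have "finite {k. eigenvalue ?M k}"
  proof -
    have "monic (char_poly ?M)" using degree_monic_char_poly[OF M] by simp
    then have "char_poly ?M \<noteq> 0" by auto
    then show ?thesis using eigenvalue_root_char_poly[OF M] poly_roots_finite by auto
  qed
  ultimately have lam: "\<Lambda> = \<mu>"
    unfolding \<Lambda>_def largest_eigenvalue_def using le by (intro Max_eqI) auto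
  have filt: "(\<Sum>w\<in>{w \<in> V. (v, w) \<in> E}. f w) = (\<Sum>w<n. A v w * f w)" for v and f :: "nat \<Rightarrow> real"
    unfolding V_def A_def by (subst sum.inter_filter) (auto intro: sum.cong)
  show thesis
  proof (rule that[of x])
    show "0 \<le> x v" for v by (rule x)
    show "\<exists>v\<in>V. x v \<noteq> 0" using x(2) by (auto simp: V_def)
    show "(\<Sum>w\<in>{w \<in> V. (v, w) \<in> E}. x w) = \<Lambda> * x v" if "v \<in> V" for v
      unfolding filt lam by (rule eig) (use that in \<open>simp add: V_def\<close>)
    show "(\<Sum>v\<in>V. \<Sum>w\<in>{w \<in> V. (v, w) \<in> E}. y v * y w) \<le> \<Lambda> * (\<Sum>v\<in>V. (y v)\<^sup>2)" for y
      using ray[of y] unfolding filt lam by (simp add: V_def sum_distrib_left mult_ac)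
  qed
qed

section \<open>Extremal graphs\<close>

lemma graphs_onI:
  assumes "sym E" "irrefl E" "E \<subseteq> {..<n} \<times> {..<n}"
  shows "\<lparr>pverts = {..<n}, parcs = E\<rparr> \<in> graphs_on n"
proof -
  have "finite E" using assms(3) finite_subset by fastforce
  then have "pair_graph \<lparr>pverts = {..<n}, parcs = E\<rparr>"
    using assms by unfold_locales (auto simp: symmetric_def irrefl_def)
  then show ?thesis by (simp add: graphs_on_def)
qed

lemma graphs_onD:
  assumes "G \<in> graphs_on n"
  shows "pverts G = {..<n}" "sym (parcs G)" "irrefl (parcs G)" "parcs G \<subseteq> {..<n} \<times> {..<n}"
    "pair_wf_digraph G"
proof -
  interpret pair_graph G using assms by (simp add: graphs_on_def)
  show pv: "pverts G = {..<n}" using assms by (simp add: graphs_on_def)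
  show "sym (parcs G)" by (auto simp: sym_def arcs_symmetric)
  show "irrefl (parcs G)" by (auto simp: irrefl_def dest: no_loops')
  show "parcs G \<subseteq> {..<n} \<times> {..<n}" using pv by (auto dest: in_arcsD1 in_arcsD2)
  show "pair_wf_digraph G" by (rule pair_wf_digraph)
qed

lemma finite_graphs_on: "finite (graphs_on n)"
proof (rule finite_subset)
  show "graphs_on n \<subseteq> (\<lambda>E. \<lparr>pverts = {..<n}, parcs = E\<rparr>) ` Pow ({..<n} \<times> {..<n})"
  proof
    fix G assume "G \<in> graphs_on n"
    note graphs_onD[OF this]
    then show "G \<in> (\<lambda>E. \<lparr>pverts = {..<n}, parcs = E\<rparr>) ` Pow ({..<n} \<times> {..<n})"
      by (intro image_eqI[of _ _ "parcs G"]) auto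
  qed
qed simp

lemma largest_eigenvalue_le_spex:
  assumes "G \<in> graphs_on n" "\<not> contains_copy G T"
  shows "largest_eigenvalue G \<le> spex n T"
  unfolding spex_def
proof (rule Max_ge)
  have "{largest_eigenvalue G |G. G \<in> graphs_on n \<and> \<not> contains_copy G T} \<subseteq> largest_eigenvalue ` graphs_on n"
    by auto
  then show "finite {largest_eigenvalue G |G. G \<in> graphs_on n \<and> \<not> contains_copy G T}"
    using finite_graphs_on finite_subset by blast
qed (use assms in auto)

lemma sqrt_le_largest_eigenvalue_complete_bipartite:
  assumes "0 < l" "l < n"
  shows "sqrt (l * (real n - l)) \<le>
    largest_eigenvalue \<lparr>pverts = {..<n}, parcs = {..<l} \<times> {l..<n} \<union> {l..<n} \<times> {..<l}\<rparr>"
    (is "_ \<le> largest_eigenvalue ?G")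
proof -
  define c where "c = sqrt (l * (real n - l))"
  have c: "0 < c" "c\<^sup>2 = l * (real n - l)" using assms by (auto simp: c_def)
  have "?G \<in> graphs_on n" by (rule graphs_onI) (use assms in \<open>auto simp: sym_def irrefl_def\<close>)
  then have ray: "(\<Sum>v<n. \<Sum>w\<in>{w \<in> {..<n}. (v, w) \<in> parcs ?G}. y v * y w) \<le> largest_eigenvalue ?G * (\<Sum>v<n. (y v)\<^sup>2)"
    for y using assms by (elim largest_eigenvalue_perron) auto
  \<comment> \<open>This is an eigenvector of the complete bipartite graph for the eigenvalue
    \<open>c\<close>.\<close>
  define y where "y v = (if v < l then c else l)" for v
  have V: "{..<n} = {..<l} \<union> {l..<n}" "{..<l} \<inter> {l..<n} = {}" using assms by auto
  have "(\<Sum>v<n. (y v)\<^sup>2) = (\<Sum>v<l. c\<^sup>2) + (\<Sum>v\<in>{l..<n}. (real l)\<^sup>2)"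
    unfolding V(1) by (subst sum.union_disjoint) (auto simp: y_def)
  also have "\<dots> = 2 * l * c\<^sup>2" using assms c(2) by (simp add: of_nat_diff power2_eq_square)
  finally have 1: "(\<Sum>v<n. (y v)\<^sup>2) = 2 * l * c\<^sup>2" .
  have "(\<Sum>v<n. \<Sum>w\<in>{w \<in> {..<n}. (v, w) \<in> parcs ?G}. y v * y w) =
      (\<Sum>v<l. \<Sum>w\<in>{l..<n}. c * l) + (\<Sum>v\<in>{l..<n}. \<Sum>w<l. l * c)"
  proof -
    have "{w \<in> {..<n}. (v, w) \<in> parcs ?G} = {l..<n}" if "v < l" for v using that assms by auto
    moreover have "{w \<in> {..<n}. (v, w) \<in> parcs ?G} = {..<l}" if "v \<in> {l..<n}" for v using that assms by auto
    ultimately show ?thesis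
      unfolding V(1) by (subst sum.union_disjoint) (auto simp: y_def)
  qed
  also have "\<dots> = c * (2 * l * c\<^sup>2)"
    unfolding c(2) using assms by (simp add: of_nat_diff algebra_simps)
  finally have "c * (2 * l * c\<^sup>2) \<le> largest_eigenvalue ?G * (2 * l * c\<^sup>2)" using ray[of y] 1 by simp
  then show ?thesis using c assms unfolding c_def[symmetric] by (simp add: mult_le_cancel_right)
qed

lemma contains_complete_bipartiteI:
  assumes "G \<in> graphs_on n" "M \<subseteq> {..<n}" "M \<times> ({..<n} - M) \<subseteq> parcs G"
  shows "contains_complete_bipartite G (card M) (n - card M)"
proof -
  define H where "H = \<lparr>pverts = {..<n}, parcs = M \<times> ({..<n} - M) \<union> ({..<n} - M) \<times> M\<rparr>"
  note G = graphs_onD[OF assms(1)]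
  have "H \<in> graphs_on n"
    unfolding H_def by (rule graphs_onI) (use assms(2) in \<open>auto simp: sym_def irrefl_def\<close>)
  then have H: "pair_wf_digraph H" by (rule graphs_onD)
  have "finite M" using assms(2) finite_subset by blast
  then have "K\<^bsub>card M, n - card M\<^esub> (with_proj H)"
    unfolding complete_bipartite_digraph_pair_def H_def using assms(2)
    by (intro conjI exI[of _ M] exI[of _ "{..<n} - M"]) (auto simp: card_Diff_subset)
  moreover have "subgraph (with_proj H) (with_proj G)"
    using H G assms(2,3) by (auto simp: subgraph_def H_def wf_digraph_wp_iff dest: symD)
  ultimately show ?thesis unfolding contains_complete_bipartite_def by blast
qed

theorem theorem1p5:
  fixes m l \<delta> :: nat and T :: "'a pair_pre_digraph"
  assumes "T \<in> tree_class m (l + 1) \<delta>"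
  shows "\<exists>N. \<forall>n>N. \<forall>G\<in>SPEX n T. contains_complete_bipartite G l (n - l)"
proof (cases "l = 0")
  case True
  then show ?thesis
    \<comment> \<open>For \<open>l = 0\<close> the empty set serves as the small side, so the
      required subgraph has no edges.\<close>
    using contains_complete_bipartiteI[of _ _ "{}"] by (auto simp: SPEX_def)
next
  case False
  then have l: "1 \<le> l" by simp
  obtain A B where T: "is_tree T" and m: "card (pverts T) = m" and AB: "bipartition T A B"
    "card A \<le> card B" "card A = l + 1"
    using assms by (auto simp: tree_class_def)
  interpret T: pair_graph T using T by (simp add: is_tree_def)
  interpret BT: bipartite_tree "pverts T" A B "parcs T" l
    using AB is_tree_tree_growth[OF T]
    by unfold_locales (auto simp: bipartition_def sym_def T.arcs_symmetric)
  have m_pos: "0 < m" using BT.l_less_m m by simp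
  define e :: real where "e = 1 / (112 * m * l)"
  define K :: real where "K = 16 * (l + 3) * m ^ 3 / e\<^sup>2"
  have e: "0 < e" using m_pos l by (simp add: e_def)
  have K: "0 \<le> K" by (simp add: K_def)
  \<comment> \<open>One summand for each size condition: the first two give n - l at least K^2,
    hence \<Lambda> at least \<open>K\<close>; the next two give \<open>l \<le> e * n\<close> and
    l^2 < 2 e n; the last is the bound on \<open>n\<close> in \<open>heavy_vertices\<close>.\<close>
  define b where "b = nat \<lceil>K\<^sup>2 + l + l / e + (real l)\<^sup>2 / (2 * e) + 16 * m * m\<rceil>"
  have copy_iff: "contains_copy G T \<longleftrightarrow> embeds (pverts T) (parcs T) {..<n} (parcs G)"
    if "G \<in> graphs_on n" for G n
    using contains_copy_iff_embeds[OF T.pair_wf_digraph graphs_onD(5)[OF that]] graphs_onD(1)[OF that] by simp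
  have "contains_complete_bipartite G l (n - l)" if n: "b < n" and G: "G \<in> SPEX n T" for n G
  proof -
    have "K\<^sup>2 + l + l / e + (real l)\<^sup>2 / (2 * e) + 16 * m * m < n"
      using n unfolding b_def by linarith
    moreover have "0 \<le> K\<^sup>2" "0 \<le> l / e" "0 \<le> (real l)\<^sup>2 / (2 * e)" using e by auto
    ultimately have nK: "K\<^sup>2 \<le> real n - l" and nl: "l < n" and ne: "l / e < n" "(real l)\<^sup>2 / (2 * e) < n"
      and nm: "16 * m * m < n"
      by (linarith, linarith, linarith, linarith, linarith)
    define V where "V = {..<n}"
    define E where "E = parcs G"
    define \<Lambda> where "\<Lambda> = largest_eigenvalue G"
    have G': "G \<in> graphs_on n" "\<not> contains_copy G T" "\<Lambda> = spex n T"
      using G by (auto simp: SPEX_def \<Lambda>_def)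
    note GE = graphs_onD[OF G'(1), folded E_def V_def]
    interpret tree_free "pverts T" A B "parcs T" l V E
      using GE G'(2) copy_iff[OF G'(1)] by unfold_locales (auto simp: V_def E_def)
    have cV: "card V = n" by (simp add: V_def)
    have n0: "0 < n" using nl by simp
    \<comment> \<open>Extremality of \<open>G\<close> against the complete bipartite graph, which
      contains no copy of \<open>T\<close>.\<close>
    have "sqrt (l * (real n - l)) \<le> \<Lambda>"
    proof -
      let ?G = "\<lparr>pverts = {..<n}, parcs = {..<l} \<times> {l..<n} \<union> {l..<n} \<times> {..<l}\<rparr>"
      have G0: "?G \<in> graphs_on n" by (rule graphs_onI) (use nl in \<open>auto simp: sym_def irrefl_def\<close>)
      have "\<not> contains_copy ?G T"
        unfolding copy_iff[OF G0] by (rule BT.not_embeds_bipartite[of _ "{..<l}" "{l..<n}"]) (use AB in auto)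
      then have "largest_eigenvalue ?G \<le> \<Lambda>" unfolding G'(3) by (rule largest_eigenvalue_le_spex[OF G0])
      then show ?thesis
        using sqrt_le_largest_eigenvalue_complete_bipartite[of l n] l nl by linarith
    qed
    moreover have "0 < l * (real n - l)" using l nl by simp
    ultimately have \<Lambda>: "0 < \<Lambda>" "l * (real n - l) \<le> \<Lambda>\<^sup>2"
      by (smt (verit) real_sqrt_gt_zero, smt (verit) real_sqrt_ge_zero real_sqrt_pow2 power_mono)
    have "K\<^sup>2 \<le> \<Lambda>\<^sup>2"
    proof -
      have "1 * (real n - l) \<le> l * (real n - l)" using l nl by (intro mult_right_mono) auto
      then have "real n - l \<le> l * (real n - l)" by simp
      from order_trans[OF this \<Lambda>(2)] nK show ?thesis by (rule order_trans[rotated])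
    qed
    then have K\<Lambda>: "K \<le> \<Lambda>" by (rule power2_le_imp_le) (rule less_imp_le[OF \<Lambda>(1)])
    obtain x where x: "\<And>v. 0 \<le> x v" "\<exists>v\<in>V. x v \<noteq> 0"
      and eig: "\<And>v. v \<in> V \<Longrightarrow> (\<Sum>w\<in>{w \<in> V. (v, w) \<in> E}. x w) = \<Lambda> * x v"
      by (rule largest_eigenvalue_perron[OF G'(1) n0, folded V_def E_def \<Lambda>_def]) blast
    define c where "c = Max (x ` V)"
    have "finite (x ` V)" "x ` V \<noteq> {}" using finite_V x(2) by auto
    then have "c \<in> x ` V" unfolding c_def by (rule Max_in)
    then obtain u where u: "u \<in> V" "x u = c" by (elim imageE) simp
    have xc: "x v \<le> c" if "v \<in> V" for v unfolding c_def using finite_V that by simp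
    have c: "0 < c"
    proof -
      obtain v where v: "v \<in> V" "x v \<noteq> 0" using x(2) by blast
      then have "0 < x v" using x(1)[of v] by simp
      then show ?thesis using xc[OF v(1)] by simp
    qed
    \<comment> \<open>Dividing by the largest entry \<open>c\<close> normalises the eigenvector;
      \<open>u\<close> then has entry 1.\<close>
    interpret tree_free_eigenvector "pverts T" A B "parcs T" l V E "\<lambda>v. x v / c" \<Lambda>
    proof unfold_locales
      show "0 < \<Lambda>" by (rule \<Lambda>(1))
      show "0 \<le> x v / c" for v using x(1)[of v] c by simp
      show "x v / c \<le> 1" if "v \<in> V" for v using xc[OF that] c by simp
      show "(\<Sum>w\<in>N v. x w / c) = \<Lambda> * (x v / c)" if "v \<in> V" for v
        using eig[OF that] by (simp add: N_def sum_divide_distrib[symmetric])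
    qed
    have xu: "x u / c = 1" using u c by simp
    have en: "l \<le> e * n" "real l ^ 2 < 2 * e * n" using ne e by (auto simp: field_simps)
    obtain M where M: "M \<subseteq> V" "card M = l" "\<And>z. z \<in> M \<Longrightarrow> 1 / 2 \<le> x z / c"
      "\<And>v. v \<in> V - M \<Longrightarrow> x v / c \<le> 1 / (8 * m)" "2 * m \<le> card {w \<in> V. M \<subseteq> N w}"
      by (rule heavy_vertices[of u, unfolded m cV, folded e_def, folded K_def, OF K\<Lambda> l en nm \<Lambda>(2) u(1) xu]) blast
    have S: "V - M - {w \<in> V. M \<subseteq> N w} = {}"
    proof (rule ccontr)
      assume ne: "V - M - {w \<in> V. M \<subseteq> N w} \<noteq> {}"
      obtain y where y: "\<Lambda> * (\<Sum>v\<in>V. (y v)\<^sup>2) < (\<Sum>v\<in>V. \<Sum>w\<in>{w \<in> V. (v, w) \<in> surgery M}. y v * y w)"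
        using surgery_increases[OF l M(1,2), unfolded m, OF _ _ ne] M(3,4) by blast
      let ?G = "\<lparr>pverts = {..<n}, parcs = surgery M\<rparr>"
      have G1: "?G \<in> graphs_on n"
      proof (rule graphs_onI[OF sym_surgery irrefl_surgery])
        show "surgery M \<subseteq> {..<n} \<times> {..<n}" using surgery_sub[OF M(1)] by (simp only: V_def)
      qed
      have "\<not> contains_copy ?G T"
        using surgery_not_embeds[OF M(1), unfolded m, OF M(5)] unfolding copy_iff[OF G1]
        by (simp add: V_def)
      then have "largest_eigenvalue ?G \<le> \<Lambda>" unfolding G'(3) by (rule largest_eigenvalue_le_spex[OF G1])
      then have "largest_eigenvalue ?G * (\<Sum>v\<in>V. (y v)\<^sup>2) \<le> \<Lambda> * (\<Sum>v\<in>V. (y v)\<^sup>2)"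
        by (intro mult_right_mono sum_nonneg) auto
      moreover have "(\<Sum>v\<in>V. \<Sum>w\<in>{w \<in> V. (v, w) \<in> surgery M}. y v * y w) \<le> largest_eigenvalue ?G * (\<Sum>v\<in>V. (y v)\<^sup>2)"
        \<comment> \<open>The Rayleigh bound for the modified graph, which extremality of
          \<open>G\<close> keeps at \<Lambda> or below, contradicts the strict gain at
          \<open>y\<close>.\<close>
        by (rule largest_eigenvalue_perron[OF G1 n0]) (simp add: V_def)
      ultimately show False using y by linarith
    qed
    have "(a, b) \<in> E" if "a \<in> M" "b \<in> V - M" for a b
      using S that sym_E by (auto simp: N_def dest: symD)
    then have "M \<times> ({..<n} - M) \<subseteq> parcs G" by (auto simp: V_def E_def)
    then show ?thesis
      using contains_complete_bipartiteI[OF G'(1), of M] M(1,2) by (simp add: V_def)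
  qed
  then show ?thesis by blast
qed

end
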